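(* Let $p$ and $q$ be distinct primes and let $G=\mathbb{Z}_p^2\times\mathbb{Z}_q$. Then Fuglede's conjecture holds on $G$: a nonempty subset $S\subseteq G$ is spectral if and only if $S$ is a tile of $G$.
   Context: $\mathbb{Z}_n$ denotes the cyclic group of order $n$. For $(a,b)\in G=\mathbb{Z}_p^2\times\mathbb{Z}_q$ let $\chi_{(a,b)}:G\to\mathbb{C}$ be the character $\chi_{(a,b)}(u,v)=e^{\frac{2\pi i}{p}\langle u,a\rangle}e^{\frac{2\pi i}{q}vb}$ for $(u,v)\in\mathbb{Z}_p^2\times\mathbb{Z}_q$, where $\langle u,a\rangle$ is the standard scalar product on $\mathbb{Z}_p^2$; these are all the irreducible characters of $G$. A nonempty subset $S\subseteq G$ is spectral if there exists $\Lambda\subseteq G$ such that the restrictions to $S$ of the characters $(\chi_l)_{l\in\Lambda}$ form an orthogonal basis of the space of complex-valued functions on $S$, with respect to the inner product $\sum_{s\in S} f(s)\overline{g(s)}$. Equivalently, $|\Lambda|=|S|$ and $\sum_{s\in S}\chi_l(s)\overline{\chi_{l'}(s)}=0$ for all distinct $l,l'\in\Lambda$. A subset $S\subseteq G$ is a tile of $G$ if there exists $T\subseteq G$ such that $S+T=G$ and $|S|\cdot|T|=|G|$ (i.e. every element of $G$ is uniquely of the form $s+t$ with $s\in S$, $t\in T$). *)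

theory Defs
  imports Complex_Main "HOL-Computational_Algebra.Primes" "HOL-Algebra.Elementary_Groups"
begin

text \<open>Elements of \<open>\<int>\<^sub>n\<close> are represented by the integers \<open>0, \<dots>, n - 1\<close>.\<close>

definition Zp2q :: "nat \<Rightarrow> nat \<Rightarrow> ((int \<times> int) \<times> int) monoid" where
  "Zp2q p q = (integer_mod_group p \<times>\<times> integer_mod_group p) \<times>\<times> integer_mod_group q"

text \<open>\<open>Zp2q_char p q (a, b) (u, v)\<close> is \<open>\<chi>\<^bsub>(a,b)\<^esub>(u,v)\<close>. The scalar product is computed in the
  integers; its value modulo \<open>p\<close> is all that matters to the exponential.\<close>

fun Zp2q_char :: "nat \<Rightarrow> nat \<Rightarrow> (int \<times> int) \<times> int \<Rightarrow> (int \<times> int) \<times> int \<Rightarrow> complex" where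
  "Zp2q_char p q ((a1, a2), b) ((u1, u2), v) =
     exp (2 * of_real pi * \<i> / of_nat p * of_int (u1 * a1 + u2 * a2)) *
     exp (2 * of_real pi * \<i> / of_nat q * of_int (v * b))"

definition inner_on :: "'a set \<Rightarrow> ('a \<Rightarrow> complex) \<Rightarrow> ('a \<Rightarrow> complex) \<Rightarrow> complex" where
  "inner_on S f g = (\<Sum>s\<in>S. f s * cnj (g s))"

text \<open>The restrictions to \<open>S\<close> of the members of the indexed family \<open>f\<close> over \<open>L\<close> are pairwise
  orthogonal, linearly independent, and span the space of functions from \<open>S\<close> to the complex
  numbers. Functions on \<open>S\<close> are total functions of which only the values on \<open>S\<close> count; being a
  family rather than a set, \<open>f\<close> may not repeat an element. Meant for finite \<open>S\<close> and \<open>L\<close>.\<close>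

definition orthogonal_basis_on :: "'a set \<Rightarrow> 'i set \<Rightarrow> ('i \<Rightarrow> 'a \<Rightarrow> complex) \<Rightarrow> bool" where
  "orthogonal_basis_on S L f \<longleftrightarrow>
     (\<forall>l\<in>L. \<forall>l'\<in>L. l \<noteq> l' \<longrightarrow> inner_on S (f l) (f l') = 0) \<and>
     (\<forall>c :: 'i \<Rightarrow> complex. (\<forall>s\<in>S. (\<Sum>l\<in>L. c l * f l s) = 0) \<longrightarrow> (\<forall>l\<in>L. c l = 0)) \<and>
     (\<forall>g :: 'a \<Rightarrow> complex. \<exists>c :: 'i \<Rightarrow> complex. \<forall>s\<in>S. g s = (\<Sum>l\<in>L. c l * f l s))"

definition spectral :: "nat \<Rightarrow> nat \<Rightarrow> ((int \<times> int) \<times> int) set \<Rightarrow> bool" where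
  "spectral p q S \<longleftrightarrow> S \<noteq> {} \<and> S \<subseteq> carrier (Zp2q p q) \<and>
     (\<exists>L \<subseteq> carrier (Zp2q p q). orthogonal_basis_on S L (Zp2q_char p q))"

definition tile :: "('a, 'b) monoid_scheme \<Rightarrow> 'a set \<Rightarrow> bool" where
  "tile G S \<longleftrightarrow> S \<subseteq> carrier G \<and>
     (\<exists>T \<subseteq> carrier G. S <#>\<^bsub>G\<^esub> T = carrier G \<and> card S * card T = order G)"

end

(* A set S tiles G, and likewise is spectral, exactly when some subgroup H of the dual group has
   order |S| and the Fourier transform of S vanishes on H \ {0}: such an H is a spectrum of S, and
   by Poisson summation S is a transversal of the annihilator of H. So both conditions have to be
   turned into the existence of H.

   The zero set of the Fourier transform is invariant under the Galois group, which makes vanishing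
   a statement about counts: it means equidistribution over cosets for a character of order p or q,
   and for one of order pq that the count over Z_p x Z_q has the form alpha_i + beta_j, whence
   |S| = q A + p B with A = 0 or B = 0 giving more zeros.

   For a tile, zeros of S and of its complement T together cover all nonzero characters, and
   |S| |T| = p^2 q leaves six cases. For a spectrum L of S, the pigeonhole principle applied to the
   differences of L finds H, except when |S| = pq and both transforms vanish on the characters of
   order q. There, suppose that no direction d has zeros of S at both (d, 0) and (d, 1). Two points
   in one level of L give a direction d with a zero at (d, 0) only, and each line in direction d
   meets a single level of L. Since q does not divide p, the transform of L does not vanish at the
   direction orthogonal to d, so S maps injectively to Z_p x Z_q along d, hence bijectively,
   and its transform vanishes at (d, 1) after all. *)
theory Submission
  imports Defs "HOL-Computational_Algebra.Computational_Algebra" "HOL-Number_Theory.Cong"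
    "HOL-Library.Product_Plus"
begin

subsection \<open>Galois conjugation of vanishing sums of roots of unity\<close>

definition ipoly :: "int poly \<Rightarrow> complex \<Rightarrow> complex" where
  "ipoly P z = poly (map_poly of_int P) z"

lemma ipoly_0 [simp]: "ipoly 0 z = 0"
  by (simp add: ipoly_def)

lemma ipoly_pCons [simp]: "ipoly (pCons a P) z = of_int a + z * ipoly P z"
  by (simp add: ipoly_def map_poly_pCons)

lemma ipoly_1 [simp]: "ipoly 1 z = 1"
  by (simp add: one_pCons)

lemma ipoly_add [simp]: "ipoly (P + Q) z = ipoly P z + ipoly Q z"
  by (induction P Q rule: poly_induct2) (simp_all add: algebra_simps)

lemma ipoly_smult [simp]: "ipoly (smult a P) z = of_int a * ipoly P z"
  by (induction P) (simp_all add: algebra_simps)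

lemma ipoly_mult [simp]: "ipoly (P * Q) z = ipoly P z * ipoly Q z"
  by (induction P) (simp_all add: algebra_simps)

lemma ipoly_minus [simp]: "ipoly (- P) z = - ipoly P z"
  using ipoly_smult[of "-1" P z] by simp

lemma ipoly_diff [simp]: "ipoly (P - Q) z = ipoly P z - ipoly Q z"
  using ipoly_add[of P "- Q" z] by simp

lemma ipoly_monom [simp]: "ipoly (monom a n) z = of_int a * z ^ n"
  by (simp add: ipoly_def map_poly_monom poly_monom)

lemma ipoly_power [simp]: "ipoly (P ^ n) z = ipoly P z ^ n"
  by (induction n) simp_all

lemma ipoly_sum: "ipoly (\<Sum>i\<in>A. f i) z = (\<Sum>i\<in>A. ipoly (f i) z)"
  by (induction A rule: infinite_finite_induct) simp_all

lemma ipoly_pcompose [simp]: "ipoly (pcompose P Q) z = ipoly P (ipoly Q z)"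
  by (induction P) (simp_all add: pcompose_pCons)

text \<open>Gauss's lemma: as \<open>f\<close> is primitive, the quotient \<open>k\<close> has the
  content of \<open>smult c P\<close>, so \<open>c\<close> divides it and cancels.\<close>

lemma primitive_dvd_smult:
  fixes f P :: "int poly"
  assumes "content f = 1" "c \<noteq> 0" "f dvd smult c P"
  shows "f dvd P"
proof -
  obtain k where k: "smult c P = f * k" using assms(3) by (elim dvdE)
  have "c dvd content k"
  proof -
    have "content (smult c P) = content k" using assms(1) by (simp add: k content_mult)
    hence "\<bar>c\<bar> * content P = content k" by simp
    thus ?thesis by (metis abs_dvd_iff dvd_triv_left)
  qed
  then obtain d where d: "content k = c * d" by (elim dvdE)
  have "smult c P = smult c (smult d (f * primitive_part k))"
    by (metis d k content_times_primitive_part mult_smult_right smult_smult)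
  hence "P = smult d (f * primitive_part k)" using assms(2) by (metis smult_cancel)
  thus ?thesis by (metis dvd_triv_left mult_smult_right)
qed

text \<open>\<open>f\<close> is the primitive part of a nonzero integer polynomial of least degree
  with root \<open>z\<close>. Pseudo-division stays within integer polynomials at the price of a
  constant factor on \<open>Q\<close>, which primitivity of \<open>f\<close> removes.\<close>

lemma ex_minimal_ipoly:
  assumes "P \<noteq> 0" "ipoly P z = 0"
  obtains f where "ipoly f z = 0" "f \<noteq> 0" "\<And>Q. ipoly Q z = 0 \<Longrightarrow> f dvd Q"
proof -
  define A where "A = (\<lambda>g. g \<noteq> 0 \<and> ipoly g z = 0)"
  have "\<exists>g. A g \<and> (\<forall>h. A h \<longrightarrow> degree g \<le> degree h)"
    using ex_has_least_nat[of A P degree] assms by (auto simp: A_def)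
  then obtain g where g: "g \<noteq> 0" "ipoly g z = 0" and
      g_min: "\<And>h. h \<noteq> 0 \<Longrightarrow> ipoly h z = 0 \<Longrightarrow> degree g \<le> degree h"
    by (auto simp: A_def)
  define f where "f = primitive_part g"
  have gf: "g = smult (content g) f" by (simp add: f_def)
  have f: "content f = 1" "f \<noteq> 0" using g(1) by (simp_all add: f_def)
  have "ipoly f z = 0" using g arg_cong[OF gf, of "\<lambda>x. ipoly x z"] by simp
  moreover have "f dvd Q" if "ipoly Q z = 0" for Q
  proof -
    obtain a q where a: "a \<noteq> 0" "smult a Q = g * q + pseudo_mod Q g"
      using pseudo_mod(1)[OF g(1), of Q] by blast
    have "ipoly (pseudo_mod Q g) z = 0"
      using arg_cong[OF a(2), of "\<lambda>x. ipoly x z"] that g by simp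
    hence "pseudo_mod Q g = 0"
      using g_min[of "pseudo_mod Q g"] pseudo_mod(2)[OF g(1), of Q] by fastforce
    hence "f dvd smult a Q" using a(2) gf by (metis add.right_neutral dvd_mult2 dvd_smult dvd_refl)
    thus ?thesis using primitive_dvd_smult f a by blast
  qed
  ultimately show ?thesis using that f by blast
qed

section \<open>The Frobenius congruence for integer polynomials\<close>

lemma prime_dvd_binomial_power:
  fixes a b :: "'a :: comm_ring_1"
  assumes "Factorial_Ring.prime r"
  shows "of_nat r dvd (a + b) ^ r - a ^ r - b ^ r"
proof -
  have r: "r > 1" using assms prime_gt_1_nat by blast
  have "{..r} = insert 0 (insert r {0<..<r})" using r by auto
  hence "(a + b) ^ r = b ^ r + (a ^ r + (\<Sum>k\<in>{0<..<r}. of_nat (r choose k) * a ^ k * b ^ (r - k)))"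
    using r by (simp add: binomial_ring)
  hence "(a + b) ^ r - a ^ r - b ^ r = (\<Sum>k\<in>{0<..<r}. of_nat (r choose k) * a ^ k * b ^ (r - k))"
    by (simp add: algebra_simps)
  moreover have "of_nat r dvd (of_nat (r choose k) :: 'a)" if "k \<in> {0<..<r}" for k
  proof -
    have "r dvd r choose k" using that assms assms by (intro dvd_choose_prime) auto
    thus ?thesis by (metis dvdE dvd_triv_left of_nat_mult)
  qed
  ultimately show ?thesis by (metis (no_types, lifting) dvd_sum dvd_mult2)
qed

lemma fermat_int_dvd:
  assumes "Factorial_Ring.prime r"
  shows "int r dvd a ^ r - a"
proof -
  have r: "r > 0" using assms prime_gt_0_nat by blast
  have nat: "int r dvd int n ^ r - int n" for n
  proof (induction n)
    case (Suc n)
    have "int r dvd (int n + 1) ^ r - int n ^ r - 1 ^ r"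
      using prime_dvd_binomial_power[OF assms, of "int n" 1] by simp
    from dvd_add[OF this Suc] show ?case by (simp add: algebra_simps)
  qed (use r in \<open>simp add: power_0_left\<close>)
  have "int r dvd int (nat (a mod int r)) ^ r - int (nat (a mod int r))" by (rule nat)
  hence "[(a mod int r) ^ r = a mod int r] (mod int r)" using r by (simp add: cong_iff_dvd_diff)
  hence "[a ^ r = a] (mod int r)" by (simp add: cong_def power_mod)
  thus ?thesis by (simp add: cong_iff_dvd_diff)
qed

text \<open>\<open>pcompose h (monom 1 r)\<close> is h(x^r). The induction peels off the constant
  coefficient: taking r-th powers is additive modulo \<open>r\<close>, and Fermat's little theorem
  fixes that coefficient.\<close>

lemma frobenius_int_poly:
  fixes h :: "int poly"
  assumes "Factorial_Ring.prime r"
  shows "of_nat r dvd h ^ r - pcompose h (monom 1 r)"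
proof (induction h)
  case 0
  thus ?case using assms by (simp add: prime_gt_0_nat power_0_left)
next
  case (pCons a h)
  let ?x = "[:0, 1:] :: int poly"
  have x: "?x ^ r = monom 1 r" by (simp add: monom_altdef)
  have 1: "pCons a h = [:a:] + ?x * h" by simp
  have "of_nat r dvd (pCons a h) ^ r - [:a:] ^ r - (?x * h) ^ r"
    unfolding 1 by (rule prime_dvd_binomial_power[OF assms])
  moreover have "of_nat r dvd [:a:] ^ r - [:a:]"
  proof -
    obtain k where "a ^ r - a = int r * k" using fermat_int_dvd[OF assms, of a] by (elim dvdE)
    hence "[:a:] ^ r - [:a:] = of_nat r * [:k:]"
      by (simp add: poly_const_pow of_nat_poly)
    thus ?thesis by (metis dvd_triv_left)
  qed
  moreover have "of_nat r dvd monom 1 r * (h ^ r - pcompose h (monom 1 r))"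
    using pCons.IH by (rule dvd_mult)
  ultimately have "of_nat r dvd ((pCons a h) ^ r - [:a:] ^ r - (?x * h) ^ r) + ([:a:] ^ r - [:a:])
      + monom 1 r * (h ^ r - pcompose h (monom 1 r))" by (intro dvd_add)
  also have "\<dots> = (pCons a h) ^ r - pcompose (pCons a h) (monom 1 r)"
    unfolding power_mult_distrib x pcompose_pCons by (simp add: algebra_simps)
  finally show ?case .
qed

text \<open>The integers meet \<open>\<int>[x] / (f)\<close> modulo \<open>r\<close> only in multiples of \<open>r\<close>, as \<open>f\<close> is monic up to sign.\<close>

lemma monic_dvd_const_minus_multiple:
  fixes f k :: "int poly"
  assumes "\<bar>lead_coeff f\<bar> = 1" "degree f > 0" "f dvd [:c:] - smult r k"
  shows "r dvd c"
proof -
  have f0: "f \<noteq> 0" using assms(2) by auto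
  obtain q R where qR: "pseudo_divmod k f = (q, R)" by fastforce
  \<comment> \<open>The factor by which pseudo-division scales \<open>k\<close>; here it is 1 or -1,
    so divisibility by \<open>r\<close> is unaffected.\<close>
  define e where "e = lead_coeff f ^ (Suc (degree k) - degree f)"
  have e: "smult e k = f * q + R" and R: "R = 0 \<or> degree R < degree f"
    using pseudo_divmod[OF f0 qR] by (simp_all add: e_def)
  have abse: "\<bar>e\<bar> = 1" using assms(1) by (simp add: e_def power_abs)
  have "f dvd smult e ([:c:] - smult r k) + f * smult r q"
    using assms(3) by (intro dvd_add[OF dvd_smult dvd_triv_left])
  also have "smult e ([:c:] - smult r k) + f * smult r q = [:e * c:] - smult r R"
    using arg_cong[OF e, of "smult r"] by (simp add: algebra_simps smult_diff_right smult_add_right)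
  finally have d: "f dvd [:e * c:] - smult r R" .
  have "degree ([:e * c:] - smult r R) < degree f"
    using R assms(2) by (intro degree_diff_less) auto
  hence "[:e * c:] - smult r R = 0" using d dvd_imp_degree_le not_le by blast
  hence "e * c - r * coeff R 0 = 0" by (metis coeff_0 coeff_diff coeff_pCons_0 coeff_smult)
  hence "r dvd e * c" by simp
  thus ?thesis using abse by (metis dvd_abs_iff abs_mult mult_1)
qed

text \<open>Dedekind's argument for the irreducibility of cyclotomic polynomials. Write x^n - 1 = f
  h with \<open>f\<close> minimal for \<open>z\<close>. If \<open>P\<close> does not vanish at z^r,
  neither does its divisor \<open>f\<close>, so z^r is a root of \<open>h\<close>, and Frobenius
  makes h(z)^r a multiple of \<open>r\<close> in Z[z]. As n z^(n-1) = f'(z) h(z), n^r is such a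
  multiple too, which forces \<open>r\<close> to divide \<open>n\<close>.\<close>

lemma galois_prime:
  assumes n: "n > 0" "z ^ n = 1" and r: "Factorial_Ring.prime r" "\<not> r dvd n" and P: "ipoly P z = 0"
  shows "ipoly P (z ^ r) = 0"
proof (rule ccontr)
  assume contra: "ipoly P (z ^ r) \<noteq> 0"
  define X where "X = (monom 1 n - 1 :: int poly)"
  have X: "X \<noteq> 0" "ipoly X z = 0"
    using n by (auto simp: X_def monom_eq_1_iff)
  obtain f where f: "ipoly f z = 0" "f \<noteq> 0" "\<And>Q. ipoly Q z = 0 \<Longrightarrow> f dvd Q"
    using ex_minimal_ipoly[OF X] by blast
  obtain h where h: "X = f * h" using f(3)[OF X(2)] by (elim dvdE)
  have lcX: "lead_coeff X = 1"
  proof -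
    have "degree X = n" using n unfolding X_def
      by (subst diff_conv_add_uminus, subst degree_add_eq_left) (simp_all add: degree_monom_eq)
    thus ?thesis using n by (simp add: X_def)
  qed
  have lcf: "\<bar>lead_coeff f\<bar> = 1"
    using lcX unfolding h lead_coeff_mult by (metis abs_zmult_eq_1 abs_1)
  have degf: "degree f > 0"
  proof (rule ccontr)
    assume "\<not> degree f > 0"
    then obtain c where "f = [:c:]" by (auto elim: degree_eq_zeroE)
    thus False using f by simp
  qed
  have "ipoly f (z ^ r) \<noteq> 0" using f(3)[OF P] contra by (auto elim!: dvdE)
  moreover have "ipoly f (z ^ r) * ipoly h (z ^ r) = 0"
    using arg_cong[OF h, of "\<lambda>x. ipoly x (z ^ r)"] n
    by (simp add: X_def power_mult[symmetric] mult.commute[of r] power_mult)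
  ultimately have "ipoly (pcompose h (monom 1 r)) z = 0" by simp
  hence 1: "f dvd pcompose h (monom 1 r)" by (rule f(3))
  obtain k where k: "h ^ r - pcompose h (monom 1 r) = of_nat r * k"
    using frobenius_int_poly[OF r(1), of h] by (elim dvdE)
  have "f dvd h ^ r - smult (int r) k"
  proof -
    have "h ^ r - smult (int r) k = pcompose h (monom 1 r)"
      using k by (simp add: of_nat_poly algebra_simps)
    thus ?thesis using 1 by simp
  qed
  then obtain j where "h ^ r - smult (int r) k = f * j" by (elim dvdE)
  hence "ipoly (h ^ r - smult (int r) k) z = 0" using f(1) by (simp only: ipoly_mult) simp
  hence hr: "ipoly h z ^ r = of_nat r * ipoly k z" by simp
  define K where "K = pderiv f ^ r * k * monom 1 r"
  have "pderiv X = monom (int n) (n - 1)" by (simp add: X_def pderiv_diff pderiv_monom)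
  hence "of_nat n * z ^ (n - 1) = ipoly (pderiv f) z * ipoly h z"
    using f(1) arg_cong[OF h, of "\<lambda>x. ipoly (pderiv x) z"] by (simp add: pderiv_mult)
  moreover have "z ^ (n - 1) * z = 1" using n by (simp flip: power_Suc2)
  ultimately have nz: "of_nat n = ipoly (pderiv f) z * ipoly h z * z"
    by (metis mult.assoc mult.right_neutral)
  have "of_nat n ^ r = of_nat r * ipoly K z"
    unfolding nz power_mult_distrib hr K_def by (simp add: ipoly_power)
  hence "f dvd [:int n ^ r:] - smult (int r) K" by (intro f(3)) simp
  hence "int r dvd int n ^ r" by (rule monic_dvd_const_minus_multiple[OF lcf degf])
  hence "r dvd n ^ r" by (metis of_nat_dvd_iff of_nat_power)
  with r show False using prime_dvd_power by blast
qed

text \<open>Induction over the prime factors of \<open>k\<close>; \<open>z\<close> is generalised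
  because each factor replaces \<open>z\<close> by z^r, again an n-th root of unity.\<close>

lemma galois_coprime:
  assumes "n > 0" "z ^ n = 1" "coprime k n" "k > 0" "ipoly P z = 0"
  shows "ipoly P (z ^ k) = 0"
  using assms
proof (induction k arbitrary: z rule: prime_divisors_induct)
  case (factor r k)
  have "\<not> r dvd n" using factor.prems factor.hyps
    by (metis coprime_common_divisor dvd_triv_left not_prime_unit)
  hence "ipoly P (z ^ r) = 0" using galois_prime factor by blast
  moreover have "(z ^ r) ^ n = 1" using factor.prems
    by (metis mult.commute power_mult power_one)
  ultimately have "ipoly P ((z ^ r) ^ k) = 0" using factor by (intro factor.IH) auto
  thus ?case by (simp add: power_mult)
qed auto

subsection \<open>Vanishing sums of order \<open>pq\<close>\<close>

definition eroot :: "nat \<Rightarrow> int \<Rightarrow> complex" where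
  "eroot n x = cis (2 * pi * of_int x / of_nat n)"

lemma eroot_0 [simp]: "eroot n 0 = 1"
  by (simp add: eroot_def)

lemma eroot_add: "eroot n (x + y) = eroot n x * eroot n y"
  by (simp add: eroot_def cis_mult add_divide_distrib ring_distribs)

lemma cnj_eroot: "cnj (eroot n x) = eroot n (- x)"
  by (simp add: eroot_def cis_cnj)

lemma eroot_power: "eroot n x ^ k = eroot n (int k * x)"
  by (simp add: eroot_def Complex.DeMoivre mult_ac)

lemma eroot_eq_1_iff:
  assumes "n > 0"
  shows "eroot n x = 1 \<longleftrightarrow> int n dvd x"
proof
  assume "eroot n x = 1"
  hence "cos (2 * pi * of_int x / of_nat n) = 1" by (simp add: eroot_def complex_eq_iff)
  then obtain k :: int where "2 * pi * of_int x / of_nat n = of_int k * (2 * pi)"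
    using cos_one_2pi_int by (auto simp: mult_ac)
  hence "real_of_int x = of_int (int n * k)" using assms by (simp add: field_simps)
  hence "x = int n * k" by (simp only: of_int_eq_iff)
  thus "int n dvd x" by simp
next
  assume "int n dvd x"
  then obtain k where "x = int n * k" by (elim dvdE)
  hence "2 * pi * of_int x / of_nat n = 2 * pi * of_int k" using assms by simp
  hence "eroot n x = cis (2 * pi * of_int k)" by (simp only: eroot_def)
  also have "\<dots> = 1" by (rule cis_multiple_2pi) simp
  finally show "eroot n x = 1" .
qed

lemma eroot_cong:
  assumes "n > 0" "int n dvd x - y"
  shows "eroot n x = eroot n y"
  using eroot_eq_1_iff[of n "x - y"] eroot_add[of n "x - y" y] assms by simp

lemma eroot_mod: "n > 0 \<Longrightarrow> eroot n (x mod int n) = eroot n x"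
  by (rule eroot_cong) (simp_all add: mod_eq_dvd_iff[symmetric])

lemma sum_eroot:
  assumes "n > 0"
  shows "(\<Sum>c<n. eroot n (int c * x)) = (if int n dvd x then of_nat n else 0)"
proof (cases "int n dvd x")
  case True
  hence "eroot n (int c * x) = 1" for c using assms by (simp add: eroot_eq_1_iff)
  thus ?thesis using True by simp
next
  case False
  hence w: "eroot n x \<noteq> 1" using assms by (simp add: eroot_eq_1_iff)
  have "(\<Sum>c<n. eroot n (int c * x)) = (\<Sum>c<n. eroot n x ^ c)" by (simp add: eroot_power)
  also have "\<dots> = (eroot n x ^ n - 1) / (eroot n x - 1)" using w by (rule geometric_sum)
  also have "eroot n x ^ n = 1" using assms by (simp add: eroot_power eroot_eq_1_iff)
  finally show ?thesis using False by simp
qed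

lemma eroot_mult:
  assumes "p > 0" "q > 0"
  shows "eroot p x * eroot q y = eroot (p * q) (int q * x + int p * y)"
  using assms by (simp add: eroot_def cis_mult field_simps)

lemma sum_eroot_residues:
  assumes "n > 1"
  shows "(\<Sum>i\<in>{0..<int n}. eroot n i) = 0"
proof -
  have "(\<Sum>i\<in>{0..<int n}. eroot n i) = (\<Sum>c<n. eroot n (int c * 1))"
    by (simp add: image_int_atLeastLessThan[of 0 n, simplified, symmetric] sum.reindex lessThan_atLeast0)
  also have "\<dots> = 0" using assms by (subst sum_eroot) auto
  finally show ?thesis .
qed

text \<open>The phases \<open>m\<close> and \<open>n\<close> are arbitrary functions, so one notion
  covers characters of order p, q and pq; a phase that is constantly 0 switches its factor
  off.\<close>

definition csum :: "nat \<Rightarrow> nat \<Rightarrow> 'a set \<Rightarrow> ('a \<Rightarrow> int) \<Rightarrow> ('a \<Rightarrow> int) \<Rightarrow> complex" where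
  "csum p q S m n = (\<Sum>s\<in>S. eroot p (m s) * eroot q (n s))"

lemma csum_commute: "csum p q S m n = csum q p S n m"
  by (simp add: csum_def mult.commute)

lemma csum_cong:
  assumes "p > 0" "q > 0"
    and "\<And>s. s \<in> S \<Longrightarrow> int p dvd m s - m' s" "\<And>s. s \<in> S \<Longrightarrow> int q dvd n s - n' s"
  shows "csum p q S m n = csum p q S m' n'"
  unfolding csum_def using assms by (intro sum.cong refl arg_cong2[of _ _ _ _ "(*)"] eroot_cong) auto

text \<open>The two phases can be scaled independently: the Chinese remainder theorem gives one
  exponent \<open>k\<close> prime to \<open>p * q\<close> that acts as \<open>c\<close> on p-th and
  as \<open>d\<close> on q-th roots of unity.\<close>

lemma csum_galois:
  assumes pq: "Factorial_Ring.prime p" "Factorial_Ring.prime q" "p \<noteq> q"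
    and c: "\<not> int p dvd c" and d: "\<not> int q dvd d"
    and zero: "csum p q S m n = 0"
  shows "csum p q S (\<lambda>s. c * m s) (\<lambda>s. d * n s) = 0"
proof -
  have pos: "p > 0" "q > 0" using pq by (simp_all add: prime_gt_0_nat)
  have "coprime p q" using pq by (simp add: primes_coprime)
  then obtain k where k: "[k = nat (c mod int p)] (mod p)" "[k = nat (d mod int q)] (mod q)"
    using binary_chinese_remainder_nat by blast
  have kc: "[int k = c] (mod int p)" and kd: "[int k = d] (mod int q)"
    using k pos by (simp_all add: cong_def flip: of_nat_mod) (simp_all add: zmod_int)
  have "\<not> p dvd k" "\<not> q dvd k"
    using kc kd c d by (metis cong_dvd_iff int_dvd_int_iff)+
  hence cop: "coprime k (p * q)" and k0: "k > 0"
    using pq by (auto intro!: Nat.gr0I simp: coprime_commute[of k] prime_imp_coprime)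
  define z where "z = eroot (p * q) 1"
  \<comment> \<open>\<open>eroot p (m s) * eroot q (n s)\<close> is \<open>z\<close> to the power
    \<open>t s\<close>, so the sum becomes an integer polynomial evaluated at
    \<open>z\<close>.\<close>
  define t where "t s = nat ((int q * m s + int p * n s) mod int (p * q))" for s
  define P where "P = (\<Sum>s\<in>S. monom (1::int) (t s))"
  have P: "ipoly P (z ^ j) = csum p q S (\<lambda>s. int j * m s) (\<lambda>s. int j * n s)" for j
  proof -
    have "(z ^ j) ^ t s = eroot p (int j * m s) * eroot q (int j * n s)" for s
    proof -
      let ?x = "int q * m s + int p * n s"
      have "(z ^ j) ^ t s = eroot (p * q) (?x mod int (p * q)) ^ j"
        using pos by (simp add: z_def t_def eroot_power mult_ac flip: power_mult)
      also have "\<dots> = eroot (p * q) (int j * ?x)"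
        using pos eroot_mod[of "p * q" ?x] by (simp add: eroot_power)
      also have "\<dots> = eroot p (int j * m s) * eroot q (int j * n s)"
        using pos by (simp add: eroot_mult algebra_simps)
      finally show ?thesis .
    qed
    thus ?thesis by (simp add: P_def ipoly_sum csum_def)
  qed
  have "ipoly P z = 0" using P[of 1] zero by simp
  moreover have "z ^ (p * q) = 1" using pos by (simp add: z_def eroot_power eroot_eq_1_iff)
  ultimately have "ipoly P (z ^ k) = 0"
    using galois_coprime cop k0 pos by (metis nat_0_less_mult_iff)
  hence "csum p q S (\<lambda>s. int k * m s) (\<lambda>s. int k * n s) = 0" by (simp add: P)
  also have "csum p q S (\<lambda>s. int k * m s) (\<lambda>s. int k * n s) = csum p q S (\<lambda>s. c * m s) (\<lambda>s. d * n s)"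
    using kc kd by (intro csum_cong pos) (simp_all add: cong_iff_dvd_diff flip: left_diff_distrib)
  finally show ?thesis .
qed

text \<open>Fourier inversion on Z_p x Z_q for the function counting the residues of the two
  phases.\<close>

lemma card_fibre2:
  fixes m n :: "'a \<Rightarrow> int"
  assumes S: "finite S" and pos: "p > 0" "q > 0"
  shows "of_nat (p * q * card {s \<in> S. int p dvd m s - i \<and> int q dvd n s - j}) =
    (\<Sum>c<p. \<Sum>d<q. eroot p (- int c * i) * eroot q (- int d * j) *
       csum p q S (\<lambda>s. int c * m s) (\<lambda>s. int d * n s))"
proof -
  have "(\<Sum>c<p. \<Sum>d<q. eroot p (- int c * i) * eroot q (- int d * j) *
       csum p q S (\<lambda>s. int c * m s) (\<lambda>s. int d * n s)) =
    (\<Sum>c<p. \<Sum>d<q. \<Sum>s\<in>S. eroot p (int c * (m s - i)) * eroot q (int d * (n s - j)))"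
  proof (intro sum.cong refl)
    fix c d
    have "eroot p (int c * (m s - i)) * eroot q (int d * (n s - j)) =
      eroot p (- int c * i) * eroot q (- int d * j) * (eroot p (int c * m s) * eroot q (int d * n s))" for s
      using eroot_add[of p "- int c * i" "int c * m s"] eroot_add[of q "- int d * j" "int d * n s"]
      by (simp add: algebra_simps)
    thus "eroot p (- int c * i) * eroot q (- int d * j) * csum p q S (\<lambda>s. int c * m s) (\<lambda>s. int d * n s)
      = (\<Sum>s\<in>S. eroot p (int c * (m s - i)) * eroot q (int d * (n s - j)))"
      by (simp add: csum_def sum_distrib_left)
  qed
  also have "\<dots> = (\<Sum>s\<in>S. \<Sum>c<p. \<Sum>d<q. eroot p (int c * (m s - i)) * eroot q (int d * (n s - j)))"
    by (simp only: sum.swap[of _ S])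
  also have "\<dots> = (\<Sum>s\<in>S. (\<Sum>c<p. eroot p (int c * (m s - i))) * (\<Sum>d<q. eroot q (int d * (n s - j))))"
    by (simp add: sum_product)
  also have "\<dots> = (\<Sum>s\<in>S. if int p dvd m s - i \<and> int q dvd n s - j then of_nat (p * q) else 0)"
    using pos by (intro sum.cong refl) (simp add: sum_eroot)
  also have "\<dots> = of_nat (p * q * card {s \<in> S. int p dvd m s - i \<and> int q dvd n s - j})"
    using S by (subst sum.inter_filter[symmetric]) (simp_all add: mult_ac)
  finally show ?thesis by simp
qed

lemma card_fibre:
  fixes m :: "'a \<Rightarrow> int"
  assumes "finite S" "p > 0"
  shows "of_nat (p * card {s \<in> S. int p dvd m s - i}) =
    (\<Sum>c<p. eroot p (- int c * i) * csum p q S (\<lambda>s. int c * m s) (\<lambda>s. 0))"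
  \<comment> \<open>Modulus 1 and phase 0 collapse the second variable.\<close>
  using card_fibre2[OF assms zero_less_one, of m i "\<lambda>_. 0" 0] by (simp add: csum_def)

lemma csum_zero_zero [simp]: "csum p q S (\<lambda>s. 0) (\<lambda>s. 0) = of_nat (card S)"
  by (simp add: csum_def)

text \<open>Galois conjugation spreads the zero to all multiples of \<open>m\<close> by units modulo
  \<open>p\<close>, so only the term \<open>c = 0\<close> survives in the inversion formula.\<close>

lemma equidistributed_fibres:
  fixes m :: "'a \<Rightarrow> int"
  assumes pq: "Factorial_Ring.prime p" "Factorial_Ring.prime q" "p \<noteq> q" and S: "finite S"
    and zero: "csum p q S m (\<lambda>s. 0) = 0"
  shows "p * card {s \<in> S. int p dvd m s - i} = card S"
proof -
  have pos: "p > 0" using pq by (simp_all add: prime_gt_0_nat)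
  have van: "csum p q S (\<lambda>s. int c * m s) (\<lambda>s. 0) = 0" if "c < p" "c \<noteq> 0" for c
    using csum_galois[OF pq _ _ zero, of "int c" 1] that pq
    by (simp add: nat_dvd_not_less) (simp add: prime_nat_iff)
  have "of_nat (p * card {s \<in> S. int p dvd m s - i}) =
    (\<Sum>c<p. eroot p (- int c * i) * csum p q S (\<lambda>s. int c * m s) (\<lambda>s. 0))"
    by (rule card_fibre[OF S pos])
  also have "\<dots> = (\<Sum>c<p. if c = 0 then of_nat (card S) else 0)"
    by (intro sum.cong refl) (auto simp: van)
  also have "\<dots> = of_nat (card S)" using pos by simp
  finally show ?thesis by (simp only: of_nat_eq_iff)
qed

text \<open>Converse to \<open>equidistributed_fibres\<close>: grouping by residues gives
  \<open>N\<close> times the sum of all p-th roots of unity.\<close>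

lemma csum_eq_0_if_equidistributed:
  fixes m :: "'a \<Rightarrow> int"
  assumes "p > 1" "finite S" and N: "\<And>i. card {s \<in> S. int p dvd m s - i} = N"
  shows "csum p q S m (\<lambda>s. 0) = 0"
proof -
  have pos: "p > 0" using assms by simp
  have "csum p q S m (\<lambda>s. 0) = (\<Sum>s\<in>S. eroot p (m s mod int p))"
    using pos by (simp add: csum_def eroot_mod)
  also have "\<dots> = (\<Sum>i\<in>{0..<int p}. \<Sum>s\<in>{s\<in>S. m s mod int p = i}. eroot p (m s mod int p))"
    using pos assms by (intro sum.group[symmetric]) auto
  also have "\<dots> = (\<Sum>i\<in>{0..<int p}. of_nat N * eroot p i)"
  proof (intro sum.cong refl)
    fix i assume i: "i \<in> {0..<int p}"
    have "{s\<in>S. m s mod int p = i} = {s \<in> S. int p dvd m s - i}"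
      using i by (auto simp: mod_eq_dvd_iff[symmetric])
    hence "card {s\<in>S. m s mod int p = i} = N" using N by simp
    moreover have "(\<Sum>s\<in>{s\<in>S. m s mod int p = i}. eroot p (m s mod int p)) =
      (\<Sum>s\<in>{s\<in>S. m s mod int p = i}. eroot p i)" by (intro sum.cong) auto
    ultimately show "(\<Sum>s\<in>{s\<in>S. m s mod int p = i}. eroot p (m s mod int p)) = of_nat N * eroot p i"
      by simp
  qed
  also have "\<dots> = 0" using assms(1) by (simp add: sum_eroot_residues flip: sum_distrib_left)
  finally show ?thesis .
qed

text \<open>In the inversion formula all terms with \<open>c\<close> and \<open>d\<close> both
  nonzero vanish by Galois conjugation. The terms on the two axes give the one-variable counts;
  their common term \<open>card S\<close> is counted twice, hence its place on the left.\<close>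

lemma fibre_relation:
  fixes m n :: "'a \<Rightarrow> int"
  assumes pq: "Factorial_Ring.prime p" "Factorial_Ring.prime q" "p \<noteq> q" and S: "finite S"
    and zero: "csum p q S m n = 0"
  shows "p * q * card {s \<in> S. int p dvd m s - i \<and> int q dvd n s - j} + card S =
    p * card {s \<in> S. int p dvd m s - i} + q * card {s \<in> S. int q dvd n s - j}"
proof -
  have pos: "p > 0" "q > 0" using pq by (simp_all add: prime_gt_0_nat)
  define f where "f c d = eroot p (- int c * i) * eroot q (- int d * j) *
       csum p q S (\<lambda>s. int c * m s) (\<lambda>s. int d * n s)" for c d
  have van: "f c d = 0" if "c < p" "c \<noteq> 0" "d < q" "d \<noteq> 0" for c d
  proof -
    have "\<not> p dvd c" "\<not> q dvd d" using that by (auto dest: dvd_imp_le)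
    thus ?thesis unfolding f_def using csum_galois[OF pq _ _ zero, of "int c" "int d"] by simp
  qed
  have inner: "(\<Sum>d<q. f c d) = (if c = 0 then (\<Sum>d<q. f 0 d) - f 0 0 else 0) + f c 0" if "c < p" for c
  proof (cases "c = 0")
    case False
    have "(\<Sum>d<q. f c d) = (\<Sum>d<q. if d = 0 then f c 0 else 0)"
      using that False by (intro sum.cong) (auto simp: van)
    thus ?thesis using False pos by simp
  qed simp
  have "of_nat (p * q * card {s \<in> S. int p dvd m s - i \<and> int q dvd n s - j}) = (\<Sum>c<p. \<Sum>d<q. f c d)"
    unfolding f_def by (rule card_fibre2[OF S pos])
  also have "\<dots> = (\<Sum>c<p. (if c = 0 then (\<Sum>d<q. f 0 d) - f 0 0 else 0) + f c 0)"
    by (intro sum.cong) (auto simp: inner)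
  also have "\<dots> = (\<Sum>d<q. f 0 d) - f 0 0 + (\<Sum>c<p. f c 0)"
    using pos by (simp add: sum.distrib)
  also have "(\<Sum>c<p. f c 0) = of_nat (p * card {s \<in> S. int p dvd m s - i})"
    by (subst card_fibre[OF S pos(1), of _ _ q]) (simp add: f_def)
  also have "(\<Sum>d<q. f 0 d) = of_nat (q * card {s \<in> S. int q dvd n s - j})"
    by (subst card_fibre[OF S pos(2), of _ _ p]) (simp add: f_def csum_commute[of p q])
  also have "f 0 0 = of_nat (card S)" by (simp add: f_def)
  finally have "(of_nat (p * q * card {s \<in> S. int p dvd m s - i \<and> int q dvd n s - j} + card S) :: complex) =
    of_nat (p * card {s \<in> S. int p dvd m s - i} + q * card {s \<in> S. int q dvd n s - j})"
    by (simp add: algebra_simps)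
  thus ?thesis by (simp only: of_nat_eq_iff)
qed

lemma sum_card_fibres:
  fixes m :: "'a \<Rightarrow> int"
  assumes "finite S" "p > 0"
  shows "(\<Sum>i\<in>{0..<int p}. card {s \<in> S. int p dvd m s - i}) = card S"
proof -
  have "card S = (\<Sum>i\<in>{0..<int p}. \<Sum>s\<in>{s\<in>S. m s mod int p = i}. 1)"
    using assms by (subst sum.group) auto
  also have "\<dots> = (\<Sum>i\<in>{0..<int p}. card {s \<in> S. int p dvd m s - i})"
  proof (intro sum.cong refl)
    fix i assume i: "i \<in> {0..<int p}"
    have "{s\<in>S. m s mod int p = i} = {s \<in> S. int p dvd m s - i}"
      using i by (auto simp: mod_eq_dvd_iff[symmetric])
    thus "(\<Sum>s\<in>{s\<in>S. m s mod int p = i}. 1) = card {s \<in> S. int p dvd m s - i}"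
      by simp
  qed
  finally show ?thesis by simp
qed

text \<open>By \<open>fibre_relation\<close> the counts \<open>N i\<close> agree modulo
  \<open>q\<close>. \<open>B\<close> is the least of them and \<open>A\<close> adds up the excesses
  over it in units of \<open>q\<close>, so \<open>A = 0\<close> means that all are equal and
  \<open>B = 0\<close> that some fibre is empty.\<close>

lemma vanishing_csum_card:
  fixes m n :: "'a \<Rightarrow> int"
  assumes pq: "Factorial_Ring.prime p" "Factorial_Ring.prime q" "p \<noteq> q" and S: "finite S"
    and zero: "csum p q S m n = 0"
  obtains A B where "card S = q * A + p * B"
    "A = 0 \<Longrightarrow> csum p q S m (\<lambda>s. 0) = 0" "B = 0 \<Longrightarrow> csum p q S (\<lambda>s. 0) n = 0"
proof -
  have pos: "p > 0" "q > 0" "p > 1" "q > 1" using pq prime_gt_0_nat prime_gt_1_nat by blast+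
  define N where "N i = card {s \<in> S. int p dvd m s - i}" for i
  define M where "M j = card {s \<in> S. int q dvd n s - j}" for j
  define NM where "NM i j = card {s \<in> S. int p dvd m s - i \<and> int q dvd n s - j}" for i j
  have rel: "p * q * NM i j + card S = p * N i + q * M j" for i j
    unfolding N_def M_def NM_def by (rule fibre_relation[OF pq S zero])
  obtain i0 where i0: "\<And>i. N i0 \<le> N i"
    using ex_has_least_nat[of "\<lambda>_. True" _ N] by auto
  have dvd: "q dvd N i - N i0" for i
  proof -
    have "p * q * NM i 0 + p * N i0 = p * q * NM i0 0 + p * N i"
      using rel[of i 0] rel[of i0 0] by simp
    hence "p * (q * NM i 0 + N i0) = p * (q * NM i0 0 + N i)" by (simp add: algebra_simps)
    hence "q * NM i 0 + N i0 = q * NM i0 0 + N i" using pos by simp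
    hence "N i - N i0 = q * NM i 0 - q * NM i0 0" using i0[of i] by linarith
    thus ?thesis by (simp flip: diff_mult_distrib2)
  qed
  define A where "A = (\<Sum>i\<in>{0..<int p}. (N i - N i0) div q)"
  have "card S = (\<Sum>i\<in>{0..<int p}. N i)"
    unfolding N_def using S pos by (simp add: sum_card_fibres)
  also have "\<dots> = (\<Sum>i\<in>{0..<int p}. q * ((N i - N i0) div q) + N i0)"
    using dvd i0 by (intro sum.cong) auto
  also have "\<dots> = q * A + p * N i0" by (simp add: A_def sum.distrib sum_distrib_left)
  finally have "card S = q * A + p * N i0" .
  moreover have "csum p q S m (\<lambda>s. 0) = 0" if "A = 0"
  proof (rule csum_eq_0_if_equidistributed[OF pos(3) S])
    fix i
    have "i mod int p \<in> {0..<int p}" using pos by simp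
    hence "(N (i mod int p) - N i0) div q = 0"
      using that unfolding A_def by (simp add: sum_eq_0_iff)
    hence "N (i mod int p) = N i0" using dvd[of "i mod int p"] i0[of "i mod int p"]
      by (metis diff_is_0_eq' dvd_div_eq_0_iff le_antisym diff_is_0_eq)
    moreover have "N (i mod int p) = N i"
    proof -
      have "int p dvd x - i mod int p \<longleftrightarrow> int p dvd x - i" for x
        by (simp flip: mod_eq_dvd_iff)
      thus ?thesis by (simp add: N_def)
    qed
    ultimately show "card {s \<in> S. int p dvd m s - i} = N i0" by (simp add: N_def)
  qed
  \<comment> \<open>Over an empty fibre the joint counts vanish, and the relation leaves every
    \<open>M j\<close> equal to \<open>card S div q\<close>.\<close>
  moreover have "csum p q S (\<lambda>s. 0) n = 0" if "N i0 = 0"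
  proof -
    have "NM i0 j = 0" for j
    proof -
      have "NM i0 j \<le> N i0" unfolding N_def NM_def using S by (intro card_mono) auto
      thus ?thesis using that by simp
    qed
    hence "card S = q * M j" for j using rel[of i0 j] that by simp
    hence "card {s \<in> S. int q dvd n s - j} = card S div q" for j
      using pos unfolding M_def by (metis nonzero_mult_div_cancel_left not_less_zero)
    from csum_eq_0_if_equidistributed[OF pos(4) S this]
    show ?thesis by (simp add: csum_commute[of p q])
  qed
  ultimately show ?thesis by (rule that)
qed

text \<open>The factor \<open>c\<close> is a coordinate of \<open>(d1, d2)\<close> times the inverse
  of the matching coordinate of \<open>(a1, a2)\<close>, taken where the latter is nonzero modulo
  \<open>p\<close>. It is a unit because \<open>(d1, d2)\<close> is nonzero.\<close>

lemma prime_collinear: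
  fixes a1 a2 d1 d2 :: int
  assumes p: "Factorial_Ring.prime p" and a: "\<not> (int p dvd a1 \<and> int p dvd a2)"
    and coll: "int p dvd d1 * a2 - d2 * a1" and d: "\<not> (int p dvd d1 \<and> int p dvd d2)"
  obtains c where "\<not> int p dvd c" "int p dvd d1 - c * a1" "int p dvd d2 - c * a2"
proof -
  have prime: "Factorial_Ring.prime (int p)" using p by simp
  have aux: "\<exists>c. int p dvd x1 - c * y1 \<and> int p dvd x2 - c * y2"
    if y: "\<not> int p dvd y1" and xy: "int p dvd x1 * y2 - x2 * y1" for x1 x2 y1 y2
  proof -
    have "coprime y1 (int p)" using prime y prime_imp_coprime coprime_commute by blast
    then obtain i where "[y1 * i = 1] (mod int p)" using cong_solve_coprime_int by blast
    then obtain t where t: "y1 * i - 1 = int p * t" unfolding cong_iff_dvd_diff by (elim dvdE)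
    obtain u where u: "x1 * y2 - x2 * y1 = int p * u" using xy by (elim dvdE)
    have "x1 - (x1 * i) * y1 = - x1 * (y1 * i - 1)" by (simp add: algebra_simps)
    also have "\<dots> = int p * (- x1 * t)" unfolding t by (simp add: algebra_simps)
    finally have "x1 - (x1 * i) * y1 = int p * (- x1 * t)" .
    hence 1: "int p dvd x1 - (x1 * i) * y1" by simp
    have "x2 - (x1 * i) * y2 = x2 * (1 - y1 * i) - i * (x1 * y2 - x2 * y1)"
      by (simp add: algebra_simps)
    also have "x2 * (1 - y1 * i) = - x2 * (y1 * i - 1)" by (simp add: algebra_simps)
    also have "\<dots> - i * (x1 * y2 - x2 * y1) = - x2 * (int p * t) - i * (int p * u)"
      unfolding u t ..
    also have "\<dots> = int p * (- x2 * t - i * u)" by (simp add: algebra_simps)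
    finally have "int p dvd x2 - (x1 * i) * y2" by simp
    with 1 show ?thesis by blast
  qed
  have "\<exists>c. int p dvd d1 - c * a1 \<and> int p dvd d2 - c * a2"
  proof (cases "int p dvd a1")
    case False
    thus ?thesis using aux coll by blast
  next
    case True
    have "int p dvd d2 * a1 - d1 * a2" using coll by (metis dvd_minus_iff minus_diff_eq)
    thus ?thesis using True a aux[of a2 d2 a1 d1] by blast
  qed
  then obtain c where c: "int p dvd d1 - c * a1" "int p dvd d2 - c * a2" by blast
  have "\<not> int p dvd c"
  proof
    assume "int p dvd c"
    hence "int p dvd c * a1" "int p dvd c * a2" by simp_all
    hence "int p dvd (d1 - c * a1) + c * a1" "int p dvd (d2 - c * a2) + c * a2"
      using c by (simp_all only: dvd_add)
    thus False using d by simp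
  qed
  thus ?thesis using that c by blast
qed

subsection \<open>Character sums on \<open>\<int>\<^sub>p\<^sup>2 \<times> \<int>\<^sub>q\<close>\<close>

type_synonym point = "(int \<times> int) \<times> int"

lemma point_cases:
  fixes x :: point
  obtains u1 u2 v where "x = ((u1, u2), v)"
  using that[of "fst (fst x)" "snd (fst x)" "snd x"] by simp

text \<open>The pairing of the components in Z_p^2, taken on whole points so that
  \<open>dot x\<close> can serve as a phase in \<open>csum\<close>.\<close>

fun dot :: "point \<Rightarrow> point \<Rightarrow> int" where
  "dot ((a1, a2), b) ((u1, u2), v) = u1 * a1 + u2 * a2"

text \<open>Sums and differences of points are computed in the integers; this map returns to the
  chosen representatives.\<close>

fun reduce :: "nat \<Rightarrow> nat \<Rightarrow> point \<Rightarrow> point" where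
  "reduce p q ((u1, u2), v) = ((u1 mod int p, u2 mod int p), v mod int q)"

text \<open>The Fourier transform of the indicator function of \<open>S\<close>, up to complex
  conjugation.\<close>

definition char_sum :: "nat \<Rightarrow> nat \<Rightarrow> point set \<Rightarrow> point \<Rightarrow> complex" where
  "char_sum p q S x = (\<Sum>s\<in>S. Zp2q_char p q x s)"

lemma zero_point: "(0 :: point) = ((0, 0), 0)"
  by (simp add: zero_prod_def)

lemma Zp2q_char_eroot: "Zp2q_char p q x s = eroot p (dot x s) * eroot q (snd s * snd x)"
  by (cases x; cases s) (auto simp: eroot_def cis_conv_exp mult_ac)

declare Zp2q_char.simps [simp del]

lemma char_sum_csum: "char_sum p q S x = csum p q S (dot x) (\<lambda>s. snd s * snd x)"
  by (simp add: char_sum_def csum_def Zp2q_char_eroot)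

lemma Zp2q_char_commute: "Zp2q_char p q x s = Zp2q_char p q s x"
  by (cases x; cases s) (auto simp: Zp2q_char_eroot mult_ac)

lemma dot_add_left: "dot (x + y) s = dot x s + dot y s"
  by (cases x; cases y; cases s) (auto simp: algebra_simps)

lemma dot_minus_left: "dot (- x) s = - dot x s"
  by (cases x; cases s) (auto simp: algebra_simps)

lemma Zp2q_char_add: "Zp2q_char p q (x + y) s = Zp2q_char p q x s * Zp2q_char p q y s"
  by (simp add: Zp2q_char_eroot dot_add_left eroot_add ring_distribs mult_ac)

lemma Zp2q_char_minus: "Zp2q_char p q (- x) s = cnj (Zp2q_char p q x s)"
  by (simp add: Zp2q_char_eroot dot_minus_left cnj_eroot)

lemma Zp2q_char_diff: "Zp2q_char p q (x - y) s = Zp2q_char p q x s * cnj (Zp2q_char p q y s)"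
  using Zp2q_char_add[of p q x "- y" s] by (simp add: Zp2q_char_minus)

lemma Zp2q_char_diff_right: "Zp2q_char p q s (x - y) = Zp2q_char p q s x * cnj (Zp2q_char p q s y)"
  using Zp2q_char_diff[of p q x y s] by (simp only: Zp2q_char_commute[of p q s])

lemma Zp2q_char_0 [simp]: "Zp2q_char p q 0 s = 1"
  by (cases s) (auto simp: Zp2q_char_eroot zero_prod_def)

lemma char_sum_0 [simp]: "char_sum p q S 0 = of_nat (card S)"
  by (simp add: char_sum_def)

lemma inner_on_Zp2q_char: "inner_on S (Zp2q_char p q l) (Zp2q_char p q l') = char_sum p q S (l - l')"
  by (simp add: inner_on_def char_sum_def Zp2q_char_diff)

locale prime_pair =
  fixes p q :: nat
  assumes p: "Factorial_Ring.prime p" and q: "Factorial_Ring.prime q" and p_neq_q: "p \<noteq> q"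
begin

abbreviation G where "G \<equiv> carrier (Zp2q p q)"
abbreviation chi where "chi \<equiv> Zp2q_char p q"
abbreviation F where "F \<equiv> char_sum p q"
abbreviation red where "red \<equiv> reduce p q"

lemma pos: "p > 0" "q > 0" "p > 1" "q > 1"
  using p q prime_gt_0_nat prime_gt_1_nat by blast+

lemma carrier_eq: "G = ({0..<int p} \<times> {0..<int p}) \<times> {0..<int q}"
  using pos by (simp add: Zp2q_def carrier_integer_mod_group)

lemma mem_carrier: "((u1, u2), v) \<in> G \<longleftrightarrow>
    0 \<le> u1 \<and> u1 < int p \<and> 0 \<le> u2 \<and> u2 < int p \<and> 0 \<le> v \<and> v < int q"
  by (auto simp: carrier_eq)

lemma finite_carrier [simp]: "finite G"
  by (simp add: carrier_eq)

lemma finite_subset_carrier: "S \<subseteq> G \<Longrightarrow> finite S"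
  using finite_subset finite_carrier by blast

lemma card_carrier: "card G = p ^ 2 * q"
  by (simp add: carrier_eq card_cartesian_product power2_eq_square)

lemma mult_eq: "x \<otimes>\<^bsub>Zp2q p q\<^esub> y = red (x + y)"
  by (cases x; cases y) (auto simp: Zp2q_def)

lemma red_in_carrier [simp]: "red x \<in> G"
  using pos by (cases x) (auto simp: carrier_eq)

lemma red_carrier: "x \<in> G \<Longrightarrow> red x = x"
  by (cases x) (auto simp: carrier_eq)

lemma zero_in_carrier [simp]: "0 \<in> G"
  using pos by (auto simp: carrier_eq zero_prod_def)

lemma red_eq_0_iff: "red ((u1, u2), v) = 0 \<longleftrightarrow> int p dvd u1 \<and> int p dvd u2 \<and> int q dvd v"
  by (simp add: zero_point mod_eq_0_iff_dvd)

lemma red_eq_red_iff: "red x = red y \<longleftrightarrow> red (x - y) = 0"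
proof -
  obtain x1 x2 x3 where x: "x = ((x1, x2), x3)" by (rule point_cases)
  obtain y1 y2 y3 where y: "y = ((y1, y2), y3)" by (rule point_cases)
  have "x - y = ((x1 - y1, x2 - y2), x3 - y3)" by (simp add: x y)
  hence "red (x - y) = 0 \<longleftrightarrow> int p dvd x1 - y1 \<and> int p dvd x2 - y2 \<and> int q dvd x3 - y3"
    by (metis red_eq_0_iff)
  moreover have "red x = red y \<longleftrightarrow> int p dvd x1 - y1 \<and> int p dvd x2 - y2 \<and> int q dvd x3 - y3"
    by (simp add: x y mod_eq_dvd_iff)
  ultimately show ?thesis by blast
qed

lemma red_diff_eq_0_iff: "x \<in> G \<Longrightarrow> y \<in> G \<Longrightarrow> red (x - y) = 0 \<longleftrightarrow> x = y"
  by (metis red_eq_red_iff red_carrier)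

lemma red_0 [simp]: "red 0 = 0"
  by (simp add: red_carrier)

lemma red_add_red: "red (x + red y) = red (x + y)"
  by (rule point_cases[of x], rule point_cases[of y]) (simp add: mod_add_right_eq)

lemma red_diff_red: "red (red x - y) = red (x - y)"
  by (rule point_cases[of x], rule point_cases[of y]) (simp add: mod_diff_left_eq)

lemma chi_eq_if_red_diff:
  assumes "red (x - y) = 0"
  shows "chi x s = chi y s"
proof -
  obtain x1 x2 x3 where x: "x = ((x1, x2), x3)" by (rule point_cases)
  obtain y1 y2 y3 where y: "y = ((y1, y2), y3)" by (rule point_cases)
  obtain s1 s2 s3 where s: "s = ((s1, s2), s3)" by (rule point_cases)
  have "int p dvd x1 - y1" "int p dvd x2 - y2" "int q dvd x3 - y3"
    using assms by (simp_all add: x y red_eq_0_iff del: reduce.simps)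
  hence "int p dvd s1 * (x1 - y1) + s2 * (x2 - y2)" "int q dvd s3 * (x3 - y3)" by auto
  hence "eroot p (dot x s) = eroot p (dot y s)" "eroot q (snd s * snd x) = eroot q (snd s * snd y)"
    using pos by (auto intro!: eroot_cong simp: x y s algebra_simps)
  thus ?thesis by (simp add: Zp2q_char_eroot)
qed

lemma chi_red [simp]: "chi (red x) s = chi x s" "chi s (red x) = chi s x"
proof -
  show "chi (red x) s = chi x s"
    by (rule chi_eq_if_red_diff) (simp only: red_diff_red diff_self red_0)
  thus "chi s (red x) = chi s x"
    using Zp2q_char_commute[of p q s x] Zp2q_char_commute[of p q s "red x"] by simp
qed

lemma F_red [simp]: "F S (red x) = F S x"
  by (simp add: char_sum_def)

lemma F_cong: "red (x - y) = 0 \<Longrightarrow> F S x = F S y"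
  by (metis F_red red_eq_red_iff)

lemma F_diff: "F L (x - y) = (\<Sum>l\<in>L. chi l x * cnj (chi l y))"
  unfolding char_sum_def
  by (simp add: Zp2q_char_diff Zp2q_char_commute[of p q x] Zp2q_char_commute[of p q y])

subsection \<open>Spectral pairs\<close>

text \<open>Row and column orthogonality of the square matrix of character values are both included,
  which makes \<open>S\<close> and \<open>L\<close> interchangeable.\<close>

definition spectral_pair :: "point set \<Rightarrow> point set \<Rightarrow> bool" where
  "spectral_pair S L \<longleftrightarrow> S \<subseteq> G \<and> L \<subseteq> G \<and> card L = card S \<and>
     (\<forall>l\<in>L. \<forall>l'\<in>L. l \<noteq> l' \<longrightarrow> F S (l - l') = 0) \<and>
     (\<forall>s\<in>S. \<forall>s'\<in>S. s \<noteq> s' \<longrightarrow> F L (s - s') = 0)"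

lemma spectral_pair_commute: "spectral_pair S L \<longleftrightarrow> spectral_pair L S"
  by (auto simp: spectral_pair_def)

lemma spectral_pairD:
  assumes "spectral_pair S L"
  shows "S \<subseteq> G" "L \<subseteq> G" "finite S" "finite L" "card L = card S"
    "\<And>l l'. l \<in> L \<Longrightarrow> l' \<in> L \<Longrightarrow> l \<noteq> l' \<Longrightarrow> F S (l - l') = 0"
    "\<And>s s'. s \<in> S \<Longrightarrow> s' \<in> S \<Longrightarrow> s \<noteq> s' \<Longrightarrow> F L (s - s') = 0"
  using assms by (auto simp: spectral_pair_def finite_subset_carrier)

text \<open>Expanding the indicator function of a point of \<open>S\<close> in the basis gives the orthogonality of the
  evaluations, hence the second half of a spectral pair and \<open>|L| = |S|\<close>.\<close>

lemma spectral_pair_if_orthogonal_basis: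
  assumes S: "S \<subseteq> G" "S \<noteq> {}" and L: "L \<subseteq> G" and basis: "orthogonal_basis_on S L chi"
  shows "spectral_pair S L"
proof -
  have fin: "finite S" "finite L" using S L by (simp_all add: finite_subset_carrier)
  note b = basis[unfolded orthogonal_basis_on_def inner_on_Zp2q_char]
  have span: "\<forall>g. \<exists>c. \<forall>s\<in>S. g s = (\<Sum>l\<in>L. c l * chi l s)"
    by (rule conjunct2[OF conjunct2[OF b]])
  have orth: "F S (l - l') = 0" if "l \<in> L" "l' \<in> L" "l \<noteq> l'" for l l'
    using conjunct1[OF b] that by simp
  have dual: "F L (s - s0) = (if s = s0 then of_nat (card S) else 0)" if s: "s \<in> S" "s0 \<in> S" for s s0
  proof -
    obtain c where c: "\<And>s. s \<in> S \<Longrightarrow> (if s = s0 then 1 else 0) = (\<Sum>l\<in>L. c l * chi l s)"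
      using spec[OF span, of "\<lambda>s. if s = s0 then 1 else 0"] by auto
    \<comment> \<open>Pairing the expansion of the indicator function of \<open>s0\<close> with
      \<open>chi l\<close> isolates the coefficient \<open>c l\<close>.\<close>
    have coef: "cnj (chi l s0) = of_nat (card S) * c l" if l: "l \<in> L" for l
    proof -
      have "cnj (chi l s0) = (\<Sum>s\<in>S. if s = s0 then cnj (chi l s) else 0)"
        using fin s by simp
      also have "\<dots> = (\<Sum>s\<in>S. (\<Sum>l'\<in>L. c l' * chi l' s) * cnj (chi l s))"
      proof (intro sum.cong refl)
        fix s assume "s \<in> S"
        show "(if s = s0 then cnj (chi l s) else 0) = (\<Sum>l'\<in>L. c l' * chi l' s) * cnj (chi l s)"
          unfolding c[OF \<open>s \<in> S\<close>, symmetric] by simp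
      qed
      also have "\<dots> = (\<Sum>s\<in>S. \<Sum>l'\<in>L. c l' * chi (l' - l) s)"
        by (simp add: Zp2q_char_diff sum_distrib_left mult_ac)
      also have "\<dots> = (\<Sum>l'\<in>L. c l' * F S (l' - l))"
        by (subst sum.swap) (simp add: char_sum_def sum_distrib_left)
      also have "\<dots> = (\<Sum>l'\<in>L. if l' = l then c l' * of_nat (card S) else 0)"
        using l by (intro sum.cong) (auto simp: orth)
      finally show ?thesis using l fin by simp
    qed
    have "F L (s - s0) = (\<Sum>l\<in>L. chi l s * cnj (chi l s0))" by (rule F_diff)
    also have "\<dots> = of_nat (card S) * (\<Sum>l\<in>L. c l * chi l s)"
      by (simp add: coef sum_distrib_left mult_ac)
    also have "\<dots> = (if s = s0 then of_nat (card S) else 0)"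
      unfolding c[OF s(1), symmetric] by simp
    finally show ?thesis .
  qed
  obtain s where "s \<in> S" using S by blast
  from dual[OF this this] have "card L = card S" by simp
  thus ?thesis using S L orth dual by (auto simp: spectral_pair_def)
qed

text \<open>Orthogonality of the characters gives independence; orthogonality of the evaluations at
  points of \<open>S\<close> gives spanning, with the usual Fourier coefficients.\<close>

lemma orthogonal_basis_if_spectral_pair:
  assumes SL: "spectral_pair S L" and S: "S \<noteq> {}"
  shows "orthogonal_basis_on S L chi"
proof -
  note D = spectral_pairD[OF SL]
  have k: "card S \<noteq> 0" using S D by simp
  have indep: "c l = 0" if c: "\<And>s. s \<in> S \<Longrightarrow> (\<Sum>l\<in>L. c l * chi l s) = 0" and l: "l \<in> L" for c l
  proof -
    have "0 = (\<Sum>s\<in>S. (\<Sum>l'\<in>L. c l' * chi l' s) * cnj (chi l s))" by (simp add: c)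
    also have "\<dots> = (\<Sum>s\<in>S. \<Sum>l'\<in>L. c l' * chi (l' - l) s)"
      by (simp add: Zp2q_char_diff sum_distrib_left mult_ac)
    also have "\<dots> = (\<Sum>l'\<in>L. c l' * F S (l' - l))"
      by (subst sum.swap) (simp add: char_sum_def sum_distrib_left)
    also have "\<dots> = (\<Sum>l'\<in>L. if l' = l then c l' * of_nat (card S) else 0)"
      using l by (intro sum.cong) (auto simp: D(6))
    finally show "c l = 0" using l D k by simp
  qed
  have span: "g s = (\<Sum>l\<in>L. (\<Sum>s0\<in>S. g s0 * cnj (chi l s0)) / of_nat (card S) * chi l s)"
    if s: "s \<in> S" for g s
  proof -
    have "(\<Sum>l\<in>L. (\<Sum>s0\<in>S. g s0 * cnj (chi l s0)) / of_nat (card S) * chi l s) =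
      (\<Sum>l\<in>L. \<Sum>s0\<in>S. g s0 * (chi l s * cnj (chi l s0))) / of_nat (card S)"
      by (simp add: sum_distrib_left sum_divide_distrib mult_ac)
    also have "(\<Sum>l\<in>L. \<Sum>s0\<in>S. g s0 * (chi l s * cnj (chi l s0))) = (\<Sum>s0\<in>S. g s0 * F L (s - s0))"
      by (subst sum.swap) (simp add: F_diff sum_distrib_left)
    also have "\<dots> = (\<Sum>s0\<in>S. if s0 = s then g s * of_nat (card S) else 0)"
      using s by (intro sum.cong) (auto simp: D(7) D(5))
    also have "\<dots> / of_nat (card S) = g s" using s k D by simp
    finally show ?thesis by simp
  qed
  show ?thesis unfolding orthogonal_basis_on_def
  proof (intro conjI ballI allI impI)
    fix g :: "point \<Rightarrow> complex"
    show "\<exists>c. \<forall>s\<in>S. g s = (\<Sum>l\<in>L. c l * chi l s)"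
      by (intro exI ballI) (rule span)
  qed (use D indep in \<open>auto simp: inner_on_Zp2q_char\<close>)
qed

lemma spectral_iff_spectral_pair:
  assumes "S \<noteq> {}"
  shows "spectral p q S \<longleftrightarrow> (\<exists>L. spectral_pair S L)"
proof
  assume "spectral p q S"
  hence S: "S \<subseteq> G" and ex: "\<exists>L\<subseteq>G. orthogonal_basis_on S L chi"
    unfolding spectral_def by simp_all
  from ex obtain L where "L \<subseteq> G" "orthogonal_basis_on S L chi" by (elim exE conjE)
  from spectral_pair_if_orthogonal_basis[OF S assms this]
  show "\<exists>L. spectral_pair S L" by (rule exI)
next
  assume "\<exists>L. spectral_pair S L"
  then obtain L where L: "spectral_pair S L" by (rule exE)
  have "\<exists>L\<subseteq>G. orthogonal_basis_on S L chi"
    by (rule exI[of _ L], rule conjI[OF spectral_pairD(2)[OF L] orthogonal_basis_if_spectral_pair[OF L assms]])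
  thus "spectral p q S"
    unfolding spectral_def by (simp add: assms spectral_pairD(1)[OF L])
qed

subsection \<open>Subgroups of vanishing characters\<close>

definition mod_subgroup :: "point set \<Rightarrow> bool" where
  "mod_subgroup H \<longleftrightarrow> H \<subseteq> G \<and> 0 \<in> H \<and> (\<forall>x\<in>H. \<forall>y\<in>H. red (x - y) \<in> H)"

text \<open>Not cut down to \<open>G\<close>, so that unreduced differences can be tested for
  membership.\<close>

definition annihilator :: "point set \<Rightarrow> point set" where
  "annihilator H = {x. \<forall>h\<in>H. chi h x = 1}"

text \<open>Translation by some \<open>h0\<close> with \<open>chi h0 x\<close> different from 1
  permutes \<open>H\<close> and multiplies the sum by a number other than 1.\<close>

lemma sum_mod_subgroup:
  assumes H: "mod_subgroup H"
  shows "(\<Sum>h\<in>H. chi h x) = (if x \<in> annihilator H then of_nat (card H) else 0)"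
proof (cases "x \<in> annihilator H")
  case False
  then obtain h0 where h0: "h0 \<in> H" "chi h0 x \<noteq> 1" by (auto simp: annihilator_def)
  have HG: "H \<subseteq> G" using H by (simp add: mod_subgroup_def)
  have "inj_on (\<lambda>h. red (h - h0)) H"
  proof (rule inj_onI)
    fix h h' assume hh: "h \<in> H" "h' \<in> H" "red (h - h0) = red (h' - h0)"
    hence "red ((h - h0) - (h' - h0)) = 0" by (simp only: red_eq_red_iff)
    hence "red (h - h') = 0" by simp
    thus "h = h'"
      using red_diff_eq_0_iff[OF subsetD[OF HG hh(1)] subsetD[OF HG hh(2)]] by (rule iffD1[rotated])
  qed
  moreover have "(\<lambda>h. red (h - h0)) ` H \<subseteq> H"
    using H h0 by (auto simp: mod_subgroup_def)
  ultimately have bij: "bij_betw (\<lambda>h. red (h - h0)) H H"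
    using endo_inj_surj[OF finite_subset_carrier[OF HG]] by (simp only: bij_betw_def)
  have "(\<Sum>h\<in>H. chi h x) = (\<Sum>h\<in>H. chi (red (h - h0)) x)"
    by (rule sum.reindex_bij_betw[OF bij, symmetric])
  also have "\<dots> = (\<Sum>h\<in>H. chi h x) * cnj (chi h0 x)"
    by (simp add: Zp2q_char_diff sum_distrib_right)
  finally have "(\<Sum>h\<in>H. chi h x) * (cnj (chi h0 x) - 1) = 0" by (simp add: algebra_simps)
  moreover have "cnj (chi h0 x) \<noteq> 1" using h0(2) by (metis complex_cnj_cnj complex_cnj_one)
  ultimately show ?thesis using False by simp
qed (simp add: annihilator_def)

text \<open>Poisson summation: after the indicator function of the annihilator is expanded in
  characters from \<open>H\<close>, only the trivial one contributes.\<close>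

lemma card_coset_inter:
  assumes H: "mod_subgroup H" and S: "finite S" and van: "\<And>h. h \<in> H \<Longrightarrow> h \<noteq> 0 \<Longrightarrow> F S h = 0"
  shows "card H * card {s \<in> S. g - s \<in> annihilator H} = card S"
proof -
  have fin: "finite H" and H0: "0 \<in> H"
    using H by (auto simp: mod_subgroup_def finite_subset_carrier)
  have "of_nat (card H * card {s \<in> S. g - s \<in> annihilator H}) =
     (\<Sum>s\<in>S. if g - s \<in> annihilator H then of_nat (card H) else 0 :: complex)"
    using S by (subst sum.inter_filter[symmetric]) simp_all
  also have "\<dots> = (\<Sum>s\<in>S. \<Sum>h\<in>H. chi h (g - s))"
    by (simp add: sum_mod_subgroup[OF H])
  also have "\<dots> = (\<Sum>s\<in>S. \<Sum>h\<in>H. chi h g * cnj (chi h s))"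
    by (simp add: Zp2q_char_diff_right)
  also have "\<dots> = (\<Sum>h\<in>H. chi h g * cnj (F S h))"
    by (subst sum.swap) (simp add: char_sum_def sum_distrib_left)
  also have "\<dots> = (\<Sum>h\<in>H. if h = 0 then of_nat (card S) else 0)"
    by (intro sum.cong) (auto simp: van)
  also have "\<dots> = of_nat (card S)" using fin H0 by simp
  finally show ?thesis by (simp only: of_nat_eq_iff)
qed

definition subgroup_spectrum :: "point set \<Rightarrow> point set \<Rightarrow> bool" where
  "subgroup_spectrum S H \<longleftrightarrow> mod_subgroup H \<and> card H = card S \<and> (\<forall>h\<in>H. h \<noteq> 0 \<longrightarrow> F S h = 0)"

text \<open>Equal cardinalities turn the count of \<open>card_coset_inter\<close> into 1:
  \<open>S\<close> is a transversal of the annihilator.\<close>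

lemma subgroup_spectrum_unique:
  assumes "subgroup_spectrum S H" "S \<subseteq> G" "S \<noteq> {}"
  shows "\<exists>!s. s \<in> S \<and> g - s \<in> annihilator H"
proof -
  have fin: "finite S" using assms finite_subset_carrier by blast
  have "card H * card {s \<in> S. g - s \<in> annihilator H} = card H"
    using assms fin card_coset_inter[of H S g] by (simp add: subgroup_spectrum_def)
  moreover have "card H \<noteq> 0" using assms fin by (simp add: subgroup_spectrum_def)
  ultimately have "card {s \<in> S. g - s \<in> annihilator H} = 1" by simp
  then obtain s where s: "{s \<in> S. g - s \<in> annihilator H} = {s}" by (rule card_1_singletonE)
  show ?thesis
  proof (rule ex1I[of _ s])
    have "s \<in> {s \<in> S. g - s \<in> annihilator H}" unfolding s by simp
    thus "s \<in> S \<and> g - s \<in> annihilator H" by simp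
  next
    fix t assume "t \<in> S \<and> g - t \<in> annihilator H"
    hence "t \<in> {s \<in> S. g - s \<in> annihilator H}" by simp
    thus "t = s" unfolding s by simp
  qed
qed

lemma annihilator_red: "red x \<in> annihilator H \<longleftrightarrow> x \<in> annihilator H"
  by (simp add: annihilator_def)

lemma zero_in_annihilator [simp]: "0 \<in> annihilator H"
  by (auto simp: annihilator_def Zp2q_char_commute[of p q _ 0])

text \<open>Differences of \<open>H\<close> stay in \<open>H\<close>, where \<open>F S\<close>
  vanishes. Distinct points of \<open>S\<close> lie in different cosets of the annihilator, so the
  sum over \<open>H\<close> vanishes at their difference.\<close>

lemma spectral_pair_if_subgroup_spectrum:
  assumes H: "subgroup_spectrum S H" and S: "S \<subseteq> G" "S \<noteq> {}"
  shows "spectral_pair S H"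
proof -
  have cl: "mod_subgroup H" and HG: "H \<subseteq> G"
    using H by (auto simp: subgroup_spectrum_def mod_subgroup_def)
  have "F S (l - l') = 0" if "l \<in> H" "l' \<in> H" "l \<noteq> l'" for l l'
  proof -
    have "red (l - l') \<in> H" using cl that by (simp add: mod_subgroup_def)
    moreover have "red (l - l') \<noteq> 0"
      using red_diff_eq_0_iff[OF subsetD[OF HG that(1)] subsetD[OF HG that(2)]] that(3) by simp
    ultimately have "F S (red (l - l')) = 0" using H unfolding subgroup_spectrum_def by blast
    thus ?thesis by simp
  qed
  moreover have "F H (s - s') = 0" if s: "s \<in> S" "s' \<in> S" "s \<noteq> s'" for s s'
  proof -
    have "s - s' \<notin> annihilator H"
    proof
      assume "s - s' \<in> annihilator H"
      moreover have "s - s \<in> annihilator H" by simp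
      ultimately show False using subgroup_spectrum_unique[OF H S, of s] s by blast
    qed
    hence "(\<Sum>h\<in>H. chi h (s - s')) = 0" using sum_mod_subgroup[OF cl, of "s - s'"] by simp
    thus ?thesis by (simp add: F_diff Zp2q_char_diff_right)
  qed
  ultimately show ?thesis using H S HG by (auto simp: spectral_pair_def subgroup_spectrum_def)
qed

lemma tile_if_subgroup_spectrum:
  assumes H: "subgroup_spectrum S H" and S: "S \<subseteq> G" "S \<noteq> {}"
  shows "tile (Zp2q p q) S"
proof -
  \<comment> \<open>The tiling complement: representatives of the annihilator.\<close>
  define T where "T = annihilator H \<inter> G"
  have uniq: "s = s'" if "s \<in> S" "s' \<in> S" "g - s \<in> annihilator H" "g - s' \<in> annihilator H" for g s s'
    using subgroup_spectrum_unique[OF H S, of g] that by blast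
  have "inj_on (\<lambda>(s, t). red (s + t)) (S \<times> T)"
  proof (rule inj_onI)
    fix z z' assume z: "z \<in> S \<times> T" "z' \<in> S \<times> T" "(\<lambda>(s, t). red (s + t)) z = (\<lambda>(s, t). red (s + t)) z'"
    define s t s' t' where st: "s = fst z" "t = snd z" "s' = fst z'" "t' = snd z'"
    have *: "s \<in> S" "t \<in> T" "s' \<in> S" "t' \<in> T" "red (s + t) = red (s' + t')"
      using z by (simp_all add: st mem_Times_iff case_prod_beta)
    \<comment> \<open>Both \<open>s\<close> and \<open>s'\<close> lie in the coset of
      \<open>s + t\<close>, and a coset contains only one point of \<open>S\<close>.\<close>
    have "red ((s + t) - s') = red (red (s + t) - s')" by (simp only: red_diff_red)
    also have "\<dots> = red t'" unfolding *(5) by (simp only: red_diff_red) simp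
    finally have "(s + t) - s' \<in> annihilator H"
      using *(4) annihilator_red by (metis IntD1 T_def)
    moreover have "(s + t) - s \<in> annihilator H" using *(2) by (simp add: T_def)
    ultimately have ss: "s = s'" using uniq * by blast
    hence "red ((s + t) - (s + t')) = 0" using *(5) by (simp only: red_eq_red_iff)
    hence "red (t - t') = 0" by simp
    moreover have "t \<in> G" "t' \<in> G" using * by (simp_all add: T_def)
    ultimately have "t = t'" using red_diff_eq_0_iff by metis
    thus "z = z'" using ss by (simp add: st prod_eq_iff)
  qed
  moreover have img: "(\<lambda>(s, t). red (s + t)) ` (S \<times> T) = G"
  proof (intro equalityI subsetI)
    fix g assume g: "g \<in> G"
    obtain s where s: "s \<in> S" "g - s \<in> annihilator H"
      using subgroup_spectrum_unique[OF H S, of g] by blast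
    have "red (g - s) \<in> T" using s by (simp add: T_def annihilator_red)
    moreover have "red (s + red (g - s)) = g" using g by (simp add: red_add_red red_carrier)
    ultimately show "g \<in> (\<lambda>(s, t). red (s + t)) ` (S \<times> T)" using s by force
  next
    fix g assume "g \<in> (\<lambda>(s, t). red (s + t)) ` (S \<times> T)"
    moreover have "(case z of (s, t) \<Rightarrow> red (s + t)) \<in> G" for z
      by (cases z) (simp only: prod.case red_in_carrier)
    ultimately show "g \<in> G" by blast
  qed
  ultimately have "card G = card (S \<times> T)" using card_image by metis
  hence "card S * card T = Coset.order (Zp2q p q)"
    by (simp add: card_cartesian_product Coset.order_def)
  moreover have "S <#>\<^bsub>Zp2q p q\<^esub> T = G"
    unfolding img[symmetric] set_mult_def
    by (auto simp: mult_eq simp del: reduce.simps add_Pair)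
  ultimately show ?thesis using S unfolding tile_def T_def by blast
qed

section \<open>Galois invariance of the zero set of \<open>F\<close>\<close>

lemma dot_scale: "dot ((c * a1, c * a2), b') s = c * dot ((a1, a2), b) s"
  by (rule point_cases[of s]) (simp add: algebra_simps)

lemma dot_snd: "dot (a, b) = dot (a, 0)"
proof
  fix s show "dot (a, b) s = dot (a, 0) s" by (rule point_cases[of s], cases a) simp
qed

lemma dot_0: "dot ((0, 0), b) = (\<lambda>s. 0)"
proof
  fix s show "dot ((0, 0), b) s = 0" by (rule point_cases[of s]) simp
qed

lemma F_0_right: "F S (a, 0) = csum p q S (dot (a, b)) (\<lambda>s. 0)"
  by (simp add: char_sum_csum dot_snd[of a b])

lemma F_0_left: "F S ((0, 0), b) = csum p q S (\<lambda>s. 0) (\<lambda>s. snd s * b)"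
  by (simp add: char_sum_csum dot_0)

lemma F_scale:
  assumes "F S ((a1, a2), b) = 0" "\<not> int p dvd c" "\<not> int q dvd d"
  shows "F S ((c * a1, c * a2), d * b) = 0"
proof -
  have "csum p q S (dot ((a1, a2), b)) (\<lambda>s. snd s * b) = 0"
    using assms(1) by (simp add: char_sum_csum)
  from csum_galois[OF p q p_neq_q assms(2,3) this]
  have "csum p q S (\<lambda>s. c * dot ((a1, a2), b) s) (\<lambda>s. d * (snd s * b)) = 0" .
  moreover have "dot ((c * a1, c * a2), d * b) = (\<lambda>s. c * dot ((a1, a2), b) s)"
    by (rule ext) (rule dot_scale)
  ultimately show ?thesis by (simp add: char_sum_csum mult.left_commute[of _ d])
qed

lemma F_vanish_card:
  assumes "finite S" "F S ((a1, a2), b) = 0"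
  obtains A B where "card S = q * A + p * B"
    "A = 0 \<Longrightarrow> F S ((a1, a2), 0) = 0" "B = 0 \<Longrightarrow> F S ((0, 0), b) = 0"
proof -
  have "csum p q S (dot ((a1, a2), b)) (\<lambda>s. snd s * b) = 0"
    using assms(2) by (simp add: char_sum_csum)
  from p q p_neq_q assms(1) this show ?thesis
  proof (rule vanishing_csum_card)
    fix A B
    assume "card S = q * A + p * B" "A = 0 \<Longrightarrow> csum p q S (dot ((a1, a2), b)) (\<lambda>s. 0) = 0"
      "B = 0 \<Longrightarrow> csum p q S (\<lambda>s. 0) (\<lambda>s. snd s * b) = 0"
    thus ?thesis by (intro that[of A B]) (simp_all add: F_0_right[of S "(a1, a2)" b] F_0_left)
  qed
qed

lemma ex_inverse:
  assumes "Factorial_Ring.prime r" "\<not> int r dvd c"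
  obtains i where "int r dvd i * c - 1" "\<not> int r dvd i"
proof -
  have "coprime c (int r)"
    using assms prime_imp_coprime[of "int r" c] by (simp add: coprime_commute)
  then obtain i where i: "[c * i = 1] (mod int r)" using cong_solve_coprime_int by blast
  hence 1: "int r dvd i * c - 1" by (simp add: cong_iff_dvd_diff mult.commute)
  have "\<not> int r dvd i"
  proof
    assume "int r dvd i"
    hence "int r dvd i * c - (i * c - 1)" by (rule dvd_diff[OF dvd_mult2 1])
    hence "is_unit (int r)" by simp
    moreover have "Factorial_Ring.prime (int r)" using assms(1) by simp
    ultimately show False using not_prime_unit by blast
  qed
  with 1 show ?thesis using that by blast
qed

text \<open>Scaling by the inverses of \<open>c\<close> and \<open>d\<close> undoes the
  multiplication. This normalises a difference of points to a chosen representative of its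
  direction.\<close>

lemma F_vanish_multiple:
  assumes van: "F S ((a1, a2), b) = 0" and c: "\<not> int p dvd c" and d: "\<not> int q dvd d"
    and a: "int p dvd a1 - c * a1'" "int p dvd a2 - c * a2'" and b: "int q dvd b - d * b'"
  shows "F S ((a1', a2'), b') = 0"
proof -
  obtain i where i: "int p dvd i * c - 1" "\<not> int p dvd i" using ex_inverse[OF p c] .
  obtain j where j: "int q dvd j * d - 1" "\<not> int q dvd j" using ex_inverse[OF q d] .
  have aux: "r dvd i * x - x'" if "r dvd i * c - 1" "r dvd x - c * x'" for r i c x x' :: int
  proof -
    have "r dvd i * (x - c * x') + (i * c - 1) * x'" using that by (intro dvd_add) simp_all
    thus ?thesis by (simp add: algebra_simps)
  qed
  have "((i * a1, i * a2), j * b) - ((a1', a2'), b') = ((i * a1 - a1', i * a2 - a2'), j * b - b')"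
    by simp
  hence "red (((i * a1, i * a2), j * b) - ((a1', a2'), b')) = 0"
    using aux[OF i(1) a(1)] aux[OF i(1) a(2)] aux[OF j(1) b] by (metis red_eq_0_iff)
  thus ?thesis using F_scale[OF van i(2) j(2)] F_cong by metis
qed

lemma not_dvd_1: "\<not> int p dvd 1" "\<not> int q dvd 1"
  using pos by simp_all

lemma carrier_dvd_eq:
  assumes "((x1, x2), x3) \<in> G" "((y1, y2), y3) \<in> G"
  shows "int p dvd x1 - y1 \<longleftrightarrow> x1 = y1" "int p dvd x2 - y2 \<longleftrightarrow> x2 = y2" "int q dvd x3 - y3 \<longleftrightarrow> x3 = y3"
  using assms by (auto simp: mem_carrier simp flip: mod_eq_dvd_iff)

subsection \<open>The subgroups occurring as spectra\<close>

text \<open>The subgroup generated by \<open>(a1, a2)\<close>; letting the factor range over all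
  integers makes closure under differences immediate.\<close>

definition line :: "int \<Rightarrow> int \<Rightarrow> (int \<times> int) set" where
  "line a1 a2 = (\<lambda>c. (c * a1 mod int p, c * a2 mod int p)) ` UNIV"

lemma card_line:
  assumes "\<not> (int p dvd a1 \<and> int p dvd a2)"
  shows "card (line a1 a2) = p"
proof -
  have "line a1 a2 = (\<lambda>c. (c * a1 mod int p, c * a2 mod int p)) ` {0..<int p}"
  proof (intro equalityI subsetI)
    fix x assume "x \<in> line a1 a2"
    then obtain c where "x = (c * a1 mod int p, c * a2 mod int p)" by (auto simp: line_def)
    hence "x = ((c mod int p) * a1 mod int p, (c mod int p) * a2 mod int p)"
      by (simp add: mod_mult_left_eq)
    moreover have "c mod int p \<in> {0..<int p}" using pos by simp
    ultimately show "x \<in> (\<lambda>c. (c * a1 mod int p, c * a2 mod int p)) ` {0..<int p}"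
      by blast
  qed (auto simp: line_def)
  moreover have "inj_on (\<lambda>c. (c * a1 mod int p, c * a2 mod int p)) {0..<int p}"
  proof (rule inj_onI)
    fix c d assume cd: "c \<in> {0..<int p}" "d \<in> {0..<int p}"
      "(c * a1 mod int p, c * a2 mod int p) = (d * a1 mod int p, d * a2 mod int p)"
    hence "int p dvd (c - d) * a1" "int p dvd (c - d) * a2"
      by (simp_all add: mod_eq_dvd_iff left_diff_distrib)
    hence "int p dvd c - d" using assms p by (auto simp: prime_dvd_mult_iff)
    thus "c = d" using cd by (auto simp flip: mod_eq_dvd_iff)
  qed
  ultimately show ?thesis by (simp add: card_image)
qed

lemma mod_subgroup_prod:
  assumes "A \<subseteq> {0..<int p} \<times> {0..<int p}" "B \<subseteq> {0..<int q}" "(0, 0) \<in> A" "0 \<in> B"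
    and A: "\<And>x y x' y'. (x, y) \<in> A \<Longrightarrow> (x', y') \<in> A \<Longrightarrow> ((x - x') mod int p, (y - y') mod int p) \<in> A"
    and B: "\<And>z z'. z \<in> B \<Longrightarrow> z' \<in> B \<Longrightarrow> (z - z') mod int q \<in> B"
  shows "mod_subgroup (A \<times> B)"
  unfolding mod_subgroup_def
proof (intro conjI ballI)
  show "A \<times> B \<subseteq> G" using assms by (auto simp: carrier_eq)
  show "0 \<in> A \<times> B" using assms by (simp add: zero_point)
  fix u v assume uv: "u \<in> A \<times> B" "v \<in> A \<times> B"
  obtain x y z where u: "u = ((x, y), z)" by (rule point_cases)
  obtain x' y' z' where v: "v = ((x', y'), z')" by (rule point_cases)
  show "red (u - v) \<in> A \<times> B" using uv A B by (simp add: u v)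
qed

lemma line_mod_subgroup:
  "line a1 a2 \<subseteq> {0..<int p} \<times> {0..<int p}" "(0, 0) \<in> line a1 a2"
  "(x, y) \<in> line a1 a2 \<Longrightarrow> (x', y') \<in> line a1 a2 \<Longrightarrow> ((x - x') mod int p, (y - y') mod int p) \<in> line a1 a2"
proof -
  show "line a1 a2 \<subseteq> {0..<int p} \<times> {0..<int p}" using pos by (auto simp: line_def)
  show "(0, 0) \<in> line a1 a2" unfolding line_def by (rule image_eqI[of _ _ 0]) simp_all
  assume "(x, y) \<in> line a1 a2" "(x', y') \<in> line a1 a2"
  then obtain c d where cd: "x = c * a1 mod int p" "y = c * a2 mod int p"
    "x' = d * a1 mod int p" "y' = d * a2 mod int p" by (auto simp: line_def)
  have "((x - x') mod int p, (y - y') mod int p) = ((c - d) * a1 mod int p, (c - d) * a2 mod int p)"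
    by (simp only: cd mod_diff_eq left_diff_distrib)
  thus "((x - x') mod int p, (y - y') mod int p) \<in> line a1 a2"
    unfolding line_def by (rule image_eqI) simp
qed

text \<open>\<open>subgroup_spectrum\<close> without the condition on cardinalities; already this
  weaker form yields divisibility of \<open>card S\<close>.\<close>

definition vanishes_on :: "point set \<Rightarrow> point set \<Rightarrow> bool" where
  "vanishes_on S H \<longleftrightarrow> mod_subgroup H \<and> (\<forall>h\<in>H. h \<noteq> 0 \<longrightarrow> F S h = 0)"

lemma vanishes_onI:
  assumes "mod_subgroup H" "\<And>h. h \<in> H \<Longrightarrow> h \<noteq> 0 \<Longrightarrow> F S h = 0"
  shows "vanishes_on S H"
  unfolding vanishes_on_def using assms by (intro conjI ballI impI)

lemma subgroup_spectrum_iff: "subgroup_spectrum S H \<longleftrightarrow> vanishes_on S H \<and> card H = card S"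
  unfolding subgroup_spectrum_def vanishes_on_def by (rule iffI; elim conjE; intro conjI; assumption)

lemma vanishes_on_dvd:
  assumes "vanishes_on S H" "finite S"
  shows "card H dvd card S"
proof -
  have "mod_subgroup H" and van: "\<forall>h\<in>H. h \<noteq> 0 \<longrightarrow> F S h = 0"
    by (rule conjunct1[OF assms(1)[unfolded vanishes_on_def]], rule conjunct2[OF assms(1)[unfolded vanishes_on_def]])
  from card_coset_inter[OF this(1) assms(2) van[rule_format]] show ?thesis by (rule dvdI[OF sym])
qed

text \<open>A nonzero element of the line is a multiple of \<open>(a1, a2)\<close> by a unit modulo
  \<open>p\<close>, so Galois scaling applies.\<close>

lemma F_line:
  assumes van: "F S ((a1, a2), b) = 0" and x: "(x1, x2) \<in> line a1 a2" "(x1, x2) \<noteq> (0, 0)"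
    and d: "\<not> int q dvd d"
  shows "F S ((x1, x2), d * b) = 0"
proof -
  from x(1) obtain c where c: "x1 = c * a1 mod int p" "x2 = c * a2 mod int p"
    by (auto simp: line_def)
  have c0: "\<not> int p dvd c"
  proof
    assume "int p dvd c"
    hence "c * a1 mod int p = 0" "c * a2 mod int p = 0" by simp_all
    hence "x1 = 0" "x2 = 0" by (simp_all only: c)
    thus False using x(2) by simp
  qed
  have "red ((c * a1, c * a2), d * b) = red ((x1, x2), d * b)" by (simp add: c)
  moreover have "F S (red ((c * a1, c * a2), d * b)) = 0"
    unfolding F_red by (rule F_scale[OF van c0 d])
  ultimately have "F S (red ((x1, x2), d * b)) = 0" by (simp only:)
  thus ?thesis unfolding F_red .
qed

lemma F_axis:
  assumes "F S ((0, 0), 1) = 0" "\<not> int q dvd d"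
  shows "F S ((0, 0), d) = 0"
  using F_scale[OF assms(1) not_dvd_1(1) assms(2)] by simp

lemma vanishes_on_line:
  assumes van: "F S ((a1, a2), 0) = 0"
  shows "vanishes_on S (line a1 a2 \<times> {0})"
proof -
  have "mod_subgroup (line a1 a2 \<times> {0})"
    using line_mod_subgroup pos by (intro mod_subgroup_prod) auto
  moreover have "F S h = 0" if "h \<in> line a1 a2 \<times> {0}" "h \<noteq> 0" for h
  proof -
    obtain x1 x2 x3 where h: "h = ((x1, x2), x3)" by (rule point_cases)
    have "(x1, x2) \<in> line a1 a2" "(x1, x2) \<noteq> (0, 0)" "x3 = 0"
      using that by (auto simp: h zero_point)
    thus ?thesis using F_line[OF van _ _ not_dvd_1(2), of x1 x2] by (simp add: h)
  qed
  ultimately show ?thesis by (rule vanishes_onI)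
qed

text \<open>The nonzero elements have order p, pq or q, and Galois scaling reduces each kind to one
  of the three assumed zeros.\<close>

lemma vanishes_on_line_axis:
  assumes van: "F S ((a1, a2), 0) = 0" "F S ((a1, a2), 1) = 0" "F S ((0, 0), 1) = 0"
  shows "vanishes_on S (line a1 a2 \<times> {0..<int q})"
proof -
  have "mod_subgroup (line a1 a2 \<times> {0..<int q})"
    using line_mod_subgroup pos by (intro mod_subgroup_prod) auto
  moreover have "F S h = 0" if "h \<in> line a1 a2 \<times> {0..<int q}" "h \<noteq> 0" for h
  proof -
    obtain x1 x2 x3 where h: "h = ((x1, x2), x3)" by (rule point_cases)
    have x: "(x1, x2) \<in> line a1 a2" "x3 \<in> {0..<int q}" using that by (auto simp: h)
    have x3: "\<not> int q dvd x3" if "x3 \<noteq> 0" using x that by (auto dest: zdvd_imp_le)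
    show ?thesis
    proof (cases "(x1, x2) = (0, 0)")
      case True
      hence "x3 \<noteq> 0" using that by (auto simp: h zero_point)
      thus ?thesis using F_axis[OF van(3) x3] True by (simp add: h)
    next
      case False
      thus ?thesis using F_line[OF van(1) x(1) False not_dvd_1(2)] F_line[OF van(2) x(1) False x3]
        by (cases "x3 = 0") (simp_all add: h)
    qed
  qed
  ultimately show ?thesis by (rule vanishes_onI)
qed

lemma vanishes_on_axis:
  assumes "F S ((0, 0), 1) = 0"
  shows "vanishes_on S ({(0, 0)} \<times> {0..<int q})"
proof -
  have "mod_subgroup ({(0, 0)} \<times> {0..<int q})" using pos by (intro mod_subgroup_prod) auto
  moreover have "F S h = 0" if "h \<in> {(0, 0)} \<times> {0..<int q}" "h \<noteq> 0" for h
  proof -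
    obtain x1 x2 x3 where h': "h = ((x1, x2), x3)" by (rule point_cases)
    have h: "h = ((0, 0), x3)" using that(1) by (simp add: h')
    have "x3 \<in> {0..<int q}" "x3 \<noteq> 0" using that by (auto simp: h zero_point)
    hence "\<not> int q dvd x3" by (auto dest: zdvd_imp_le)
    thus ?thesis using F_axis[OF assms] by (simp add: h)
  qed
  ultimately show ?thesis by (rule vanishes_onI)
qed

lemma vanishes_on_plane:
  assumes "\<And>a1 a2. \<not> (int p dvd a1 \<and> int p dvd a2) \<Longrightarrow> F S ((a1, a2), 0) = 0"
  shows "vanishes_on S (({0..<int p} \<times> {0..<int p}) \<times> {0})"
proof -
  have "mod_subgroup (({0..<int p} \<times> {0..<int p}) \<times> {0})"
    using pos by (intro mod_subgroup_prod) auto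
  moreover have "F S h = 0" if "h \<in> ({0..<int p} \<times> {0..<int p}) \<times> {0}" "h \<noteq> 0" for h
  proof -
    obtain x1 x2 x3 where h: "h = ((x1, x2), x3)" by (rule point_cases)
    have "x1 \<in> {0..<int p}" "x2 \<in> {0..<int p}" "x3 = 0"
      using that(1) by (simp_all add: h)
    moreover from this have "x1 \<noteq> 0 \<or> x2 \<noteq> 0"
      using that(2) by (auto simp: h zero_point)
    ultimately have "x3 = 0" "\<not> (int p dvd x1 \<and> int p dvd x2)" by (auto dest: zdvd_imp_le)
    thus ?thesis using assms by (simp add: h)
  qed
  ultimately show ?thesis by (rule vanishes_onI)
qed

lemma card_plane: "card (({0..<int p} \<times> {0..<int p}) \<times> {0::int}) = p ^ 2"
  by (simp add: card_cartesian_product power2_eq_square)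

lemma mod_subgroup_carrier: "mod_subgroup G"
  unfolding mod_subgroup_def by (intro conjI ballI subset_refl zero_in_carrier red_in_carrier)

lemma vanishes_on_carrier: "vanishes_on G G"
proof -
  have "F G h = 0" if "h \<in> G" "h \<noteq> 0" for h
  proof -
    obtain x1 x2 x3 where h: "h = ((x1, x2), x3)" by (rule point_cases)
    have "h \<notin> annihilator G"
    proof
      assume ann: "h \<in> annihilator G"
      \<comment> \<open>Characters at the three standard generators detect every coordinate of
        \<open>h\<close>.\<close>
      have e: "((1, 0), 0) \<in> G" "((0, 1), 0) \<in> G" "((0, 0), 1) \<in> G"
        using pos by (auto simp: mem_carrier)
      have "chi ((1, 0), 0) h = 1" "chi ((0, 1), 0) h = 1" "chi ((0, 0), 1) h = 1"
        using ann e by (simp_all add: annihilator_def)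
      hence "int p dvd x1" "int p dvd x2" "int q dvd x3"
        using pos by (simp_all add: Zp2q_char_eroot h eroot_eq_1_iff)
      hence "red h = 0" by (simp only: h red_eq_0_iff)
      thus False using that(2) unfolding red_carrier[OF that(1)] by (rule notE[rotated])
    qed
    hence "(\<Sum>g\<in>G. chi g h) = 0"
      using sum_mod_subgroup[OF mod_subgroup_carrier, of h] by simp
    thus ?thesis by (simp add: char_sum_def Zp2q_char_commute[of p q h])
  qed
  thus ?thesis by (rule vanishes_onI[OF mod_subgroup_carrier])
qed

subsection \<open>Spectral sets\<close>

lemma char_sum_diff:
  assumes "spectral_pair S L" "((x1, x2), x3) \<in> L" "((y1, y2), y3) \<in> L"
    "((x1, x2), x3) \<noteq> ((y1, y2), y3)"
  shows "F S ((x1 - y1, x2 - y2), x3 - y3) = 0"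
  using spectral_pairD(6)[OF assms] by simp

text \<open>More than \<open>p\<close> points cannot lie on distinct lines of a parallel class in
  the plane, so two of them differ by a multiple of \<open>(a1, a2)\<close>; injectivity of
  \<open>fst\<close> keeps that multiple nonzero.\<close>

lemma all_directions:
  assumes L: "L \<subseteq> G" "inj_on fst L" "card L > p"
    and van: "\<And>x1 x2 x3 y1 y2 y3. ((x1, x2), x3) \<in> L \<Longrightarrow> ((y1, y2), y3) \<in> L \<Longrightarrow>
      (x1, x2) \<noteq> (y1, y2) \<Longrightarrow> F S ((x1 - y1, x2 - y2), 0) = 0"
    and a: "\<not> (int p dvd a1 \<and> int p dvd a2)"
  shows "F S ((a1, a2), 0) = 0"
proof -
  \<comment> \<open>A linear form on the plane whose kernel modulo \<open>p\<close> is spanned by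
    \<open>(a1, a2)\<close>.\<close>
  define f :: "point \<Rightarrow> int" where "f l = (fst (fst l) * a2 - snd (fst l) * a1) mod int p" for l
  have "f ` L \<subseteq> {0..<int p}" using pos by (auto simp: f_def)
  hence "card (f ` L) < card L" using L(3) card_mono[of "{0..<int p}" "f ` L"] by simp
  hence "\<not> inj_on f L" by (rule pigeonhole)
  then obtain x y where xy: "x \<in> L" "y \<in> L" "x \<noteq> y" "f x = f y"
    unfolding inj_on_def by blast
  obtain x1 x2 x3 where x: "x = ((x1, x2), x3)" by (rule point_cases)
  obtain y1 y2 y3 where y: "y = ((y1, y2), y3)" by (rule point_cases)
  have ne: "(x1, x2) \<noteq> (y1, y2)" using inj_onD[OF L(2) _ xy(1,2)] xy(3) by (auto simp: x y)
  have "x \<in> G" "y \<in> G" using L xy by blast+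
  hence d: "\<not> (int p dvd x1 - y1 \<and> int p dvd x2 - y2)"
    using ne by (simp add: x y carrier_dvd_eq)
  have "int p dvd (x1 * a2 - x2 * a1) - (y1 * a2 - y2 * a1)"
    using xy(4) by (simp add: f_def x y mod_eq_dvd_iff)
  hence "int p dvd (x1 - y1) * a2 - (x2 - y2) * a1" by (simp add: algebra_simps)
  then obtain c where c: "\<not> int p dvd c" "int p dvd (x1 - y1) - c * a1" "int p dvd (x2 - y2) - c * a2"
    using prime_collinear[OF p a _ d] by blast
  have "F S ((x1 - y1, x2 - y2), 0) = 0" using van xy ne by (simp add: x y)
  thus ?thesis using c(1) not_dvd_1(2) c(2,3) by (rule F_vanish_multiple) simp
qed

text \<open>Two points of \<open>L\<close> over the same point of the plane differ by a character of
  order q.\<close>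

lemma axis_difference:
  assumes SL: "spectral_pair S L" and inj: "\<not> inj_on fst L"
  shows "F S ((0, 0), 1) = 0"
proof -
  obtain x y where xy: "x \<in> L" "y \<in> L" "x \<noteq> y" "fst x = fst y"
    using inj unfolding inj_on_def by blast
  obtain x1 x2 x3 where x: "x = ((x1, x2), x3)" by (rule point_cases)
  obtain y1 y2 y3 where y: "y = ((y1, y2), y3)" by (rule point_cases)
  have eq: "x1 = y1" "x2 = y2" "x3 \<noteq> y3" using xy by (auto simp: x y)
  have "x \<in> G" "y \<in> G" using spectral_pairD(2)[OF SL] xy by blast+
  hence d: "\<not> int q dvd x3 - y3" using eq by (simp add: x y carrier_dvd_eq)
  have "F S ((0, 0), x3 - y3) = 0"
    using char_sum_diff[OF SL, of x1 x2 x3 y1 y2 y3] xy eq by (simp add: x y)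
  thus ?thesis using not_dvd_1(1) d by (rule F_vanish_multiple) simp_all
qed

lemma inj_fst_card:
  assumes "L \<subseteq> G" "inj_on fst L"
  shows "card L \<le> p ^ 2"
proof -
  have "fst ` L \<subseteq> {0..<int p} \<times> {0..<int p}"
    using assms(1) by (auto simp: carrier_eq)
  hence "card (fst ` L) \<le> card ({0..<int p} \<times> {0..<int p})" by (intro card_mono) auto
  thus ?thesis using assms(2) by (simp add: card_image card_cartesian_product power2_eq_square)
qed

lemma subgroup_spectrum_plane:
  assumes "finite S" "S \<noteq> {}" "card S \<le> p ^ 2"
    and "\<And>a1 a2. \<not> (int p dvd a1 \<and> int p dvd a2) \<Longrightarrow> F S ((a1, a2), 0) = 0"
  shows "\<exists>H. subgroup_spectrum S H" "card S = p ^ 2"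
proof -
  have van: "vanishes_on S (({0..<int p} \<times> {0..<int p}) \<times> {0})"
    using assms(4) by (rule vanishes_on_plane)
  have "p ^ 2 dvd card S" using vanishes_on_dvd[OF van assms(1)] by (simp only: card_plane)
  moreover have "card S > 0" using assms by (simp add: card_gt_0_iff)
  ultimately show card: "card S = p ^ 2" using assms(3) dvd_imp_le le_antisym by blast
  show "\<exists>H. subgroup_spectrum S H" using van card card_plane subgroup_spectrum_iff by metis
qed

text \<open>Some level of \<open>L\<close>, with fixed component in Z_q, has more than
  \<open>p\<close> points, so \<open>F S\<close> vanishes in every planar direction. If
  \<open>L\<close> projects injectively to the plane, the plane is the subgroup sought; otherwise
  \<open>F S\<close> vanishes at \<open>((0, 0), 1)\<close> too, \<open>p ^ 2 * q\<close> divides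
  \<open>card S\<close>, and \<open>S\<close> is all of \<open>G\<close>.\<close>

lemma spectrum_large:
  assumes SL: "spectral_pair S L" and k: "card S > p * q"
  shows "\<exists>H. subgroup_spectrum S H"
proof -
  note D = spectral_pairD[OF SL]
  have S0: "S \<noteq> {}" using k by auto
  define Lv where "Lv v = {l \<in> L. snd l = v}" for v
  have "\<exists>v. card (Lv v) > p"
  proof (rule ccontr)
    assume "\<not> ?thesis"
    hence le: "card (Lv v) \<le> p" for v by (simp add: not_less)
    have "L \<subseteq> (\<Union>v\<in>{0..<int q}. Lv v)"
      using D(2) by (auto simp: Lv_def carrier_eq)
    hence "card L \<le> card (\<Union>v\<in>{0..<int q}. Lv v)"
      using D(4) by (intro card_mono) (auto simp: Lv_def)
    also have "\<dots> \<le> (\<Sum>v\<in>{0..<int q}. card (Lv v))" by (rule card_UN_le) simp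
    also have "\<dots> \<le> (\<Sum>v\<in>{0..<int q}. p)" using le by (intro sum_mono)
    finally show False using k D(5) by (simp add: mult.commute)
  qed
  then obtain v where v: "card (Lv v) > p" by blast
  have LvL: "Lv v \<subseteq> L" "\<And>l. l \<in> Lv v \<Longrightarrow> snd l = v"
    by (simp_all add: Lv_def)
  have dirs: "F S ((a1, a2), 0) = 0" if "\<not> (int p dvd a1 \<and> int p dvd a2)" for a1 a2
  proof (rule all_directions[OF _ _ v _ that])
    show "Lv v \<subseteq> G" using LvL(1) D(2) by (rule subset_trans)
    show "inj_on fst (Lv v)" by (rule inj_onI) (simp add: LvL(2) prod_eq_iff)
    fix x1 x2 x3 y1 y2 y3
    assume *: "((x1, x2), x3) \<in> Lv v" "((y1, y2), y3) \<in> Lv v" "(x1, x2) \<noteq> (y1, y2)"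
    hence "x3 = v" "y3 = v" using LvL(2) by fastforce+
    thus "F S ((x1 - y1, x2 - y2), 0) = 0"
      using char_sum_diff[OF SL, of x1 x2 x3 y1 y2 y3] * LvL(1) by auto
  qed
  show ?thesis
  proof (cases "inj_on fst L")
    case True
    hence "card S \<le> p ^ 2" using inj_fst_card D by metis
    thus ?thesis using subgroup_spectrum_plane(1)[OF D(3) S0 _ dirs] by blast
  next
    case False
    have "F S ((0, 0), 1) = 0" using axis_difference[OF SL False] .
    hence "q dvd card S"
      using vanishes_on_dvd[OF vanishes_on_axis D(3)] by (simp add: card_cartesian_product)
    moreover have "vanishes_on S (({0..<int p} \<times> {0..<int p}) \<times> {0})"
      using dirs by (rule vanishes_on_plane)
    hence "p ^ 2 dvd card S" using vanishes_on_dvd[OF _ D(3)] card_plane by metis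
    moreover have "coprime (p ^ 2) q" using p q p_neq_q by (simp add: primes_coprime)
    ultimately have "p ^ 2 * q dvd card S" by (simp add: divides_mult)
    hence "card G \<le> card S" unfolding card_carrier using k by (intro dvd_imp_le) simp_all
    hence "S = G" using D(1) card_seteq[OF finite_carrier] by blast
    thus ?thesis using vanishes_on_carrier subgroup_spectrum_iff by blast
  qed
qed

text \<open>If the characters trivial on \<open>\<int>\<^sub>p\<^sup>2\<close> do not vanish on \<open>S\<close>, everything happens in the
  projection to \<open>\<int>\<^sub>p\<^sup>2\<close>.\<close>

lemma spectrum_no_axis:
  assumes SL: "spectral_pair S L" and k: "card S \<le> p * q" "card S > 1" and ax: "F S ((0, 0), 1) \<noteq> 0"
  shows "\<exists>H. subgroup_spectrum S H" "card S = p \<or> card S = p ^ 2"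
proof -
  note D = spectral_pairD[OF SL]
  have inj: "inj_on fst L" using axis_difference[OF SL] ax by blast
  have axis: "F S ((0, 0), d) \<noteq> 0" if "\<not> int q dvd d" for d
  proof
    assume "F S ((0, 0), d) = 0"
    hence "F S ((0, 0), 1) = 0" using not_dvd_1(1) that by (rule F_vanish_multiple) simp_all
    thus False using ax by simp
  qed
  \<comment> \<open>For points on different levels \<open>F_vanish_card\<close> applies;
    \<open>B = 0\<close> is ruled out since it would give a zero on the axis.\<close>
  have diff: "(int q dvd x3 - y3 \<and> F S ((x1 - y1, x2 - y2), 0) = 0) \<or>
      (\<exists>A B. card S = q * A + p * B \<and> (A = 0 \<longrightarrow> F S ((x1 - y1, x2 - y2), 0) = 0) \<and> B \<noteq> 0)"
    if xy: "((x1, x2), x3) \<in> L" "((y1, y2), y3) \<in> L" "(x1, x2) \<noteq> (y1, y2)" for x1 x2 x3 y1 y2 y3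
  proof -
    have van: "F S ((x1 - y1, x2 - y2), x3 - y3) = 0"
      by (rule char_sum_diff[OF SL xy(1,2)]) (use xy(3) in auto)
    show ?thesis
    proof (cases "int q dvd x3 - y3")
      case True
      hence "F S ((x1 - y1, x2 - y2), 0) = 0"
        using F_vanish_multiple[OF van not_dvd_1, of "x1 - y1" "x2 - y2" 0] by simp
      thus ?thesis using True by blast
    next
      case False
      show ?thesis
      proof (rule F_vanish_card[OF D(3) van])
        fix A B
        assume AB: "card S = q * A + p * B" "A = 0 \<Longrightarrow> F S ((x1 - y1, x2 - y2), 0) = 0"
          "B = 0 \<Longrightarrow> F S ((0, 0), x3 - y3) = 0"
        have "B \<noteq> 0" using AB(3) axis[OF False] by blast
        thus ?thesis using AB by blast
      qed
    qed
  qed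
  have p_dvd_if: "p dvd card S" if "F S ((a1, a2), 0) = 0" "\<not> (int p dvd a1 \<and> int p dvd a2)" for a1 a2
    using vanishes_on_dvd[OF vanishes_on_line[OF that(1)] D(3)] card_line[OF that(2)]
    by (simp add: card_cartesian_product)
  have nz: "\<not> (int p dvd x1 - y1 \<and> int p dvd x2 - y2)"
    if "((x1, x2), x3) \<in> L" "((y1, y2), y3) \<in> L" "(x1, x2) \<noteq> (y1, y2)" for x1 x2 x3 y1 y2 y3
  proof -
    have "((x1, x2), x3) \<in> G" "((y1, y2), y3) \<in> G" using that D(2) by blast+
    thus ?thesis using that(3) by (simp add: carrier_dvd_eq)
  qed
  have "\<not> card L \<le> Suc 0" using k(2) D(5) by simp
  then obtain x y where xy: "x \<in> L" "y \<in> L" "x \<noteq> y"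
    unfolding card_le_Suc0_iff_eq[OF D(4)] by blast
  obtain x1 x2 x3 where x: "x = ((x1, x2), x3)" by (rule point_cases)
  obtain y1 y2 y3 where y: "y = ((y1, y2), y3)" by (rule point_cases)
  have ne: "(x1, x2) \<noteq> (y1, y2)" using inj_onD[OF inj _ xy(1,2)] xy(3) by (auto simp: x y)
  have xyL: "((x1, x2), x3) \<in> L" "((y1, y2), y3) \<in> L" using xy by (simp_all add: x y)
  have pk: "p dvd card S"
  proof (cases "inj_on snd L")
    case False
    then obtain x y where xy: "x \<in> L" "y \<in> L" "x \<noteq> y" "snd x = snd y"
      unfolding inj_on_def by blast
    obtain x1 x2 x3 where x: "x = ((x1, x2), x3)" by (rule point_cases)
    obtain y1 y2 y3 where y: "y = ((y1, y2), y3)" by (rule point_cases)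
    have ne: "(x1, x2) \<noteq> (y1, y2)" "x3 = y3" using xy by (auto simp: x y)
    have "F S ((x1 - y1, x2 - y2), 0) = 0"
      using char_sum_diff[OF SL, of x1 x2 x3 y1 y2 y3] xy ne by (simp add: x y)
    thus ?thesis using p_dvd_if nz[of x1 x2 x3 y1 y2 y3] xy ne by (simp add: x y)
  next
    case True
    have "snd ` L \<subseteq> {0..<int q}" using D(2) by (auto simp: carrier_eq)
    hence "card (snd ` L) \<le> card {0..<int q}" by (intro card_mono) auto
    \<comment> \<open>With one point per level at most, \<open>card S\<close> is too small for
      \<open>A\<close> and \<open>B\<close> both to be positive.\<close>
    hence kq: "card S \<le> q" using True D(5) by (simp add: card_image)
    from diff[OF xyL ne] show ?thesis
    proof (elim disjE exE conjE)
      assume "F S ((x1 - y1, x2 - y2), 0) = 0"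
      thus ?thesis using p_dvd_if nz[OF xyL ne] by blast
    next
      fix A B assume AB: "card S = q * A + p * B" "B \<noteq> 0"
      have "A = 0"
      proof (rule ccontr)
        assume "A \<noteq> 0"
        hence "q * 1 \<le> q * A" by (intro mult_le_mono2) simp
        moreover have "p * B > 0" using AB(2) pos by simp
        ultimately show False using AB(1) kq by linarith
      qed
      thus ?thesis using AB by simp
    qed
  qed
  \<comment> \<open>Divisibility of \<open>card S\<close> by \<open>p\<close> carries over to
    \<open>A\<close>; a nonzero \<open>A\<close> would make \<open>q * A + p * B\<close> exceed
    \<open>p * q\<close>.\<close>
  have vanish: "F S ((x1 - y1, x2 - y2), 0) = 0"
    if xy: "((x1, x2), x3) \<in> L" "((y1, y2), y3) \<in> L" "(x1, x2) \<noteq> (y1, y2)" for x1 x2 x3 y1 y2 y3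
  proof -
    have "A = 0" if AB: "card S = q * A + p * B" "B \<noteq> 0" for A B
    proof (rule ccontr)
      assume "A \<noteq> 0"
      have "p dvd q * A" using pk unfolding AB(1) by (simp add: dvd_add_left_iff)
      hence "p dvd A" using p q p_neq_q by (metis prime_dvd_mult_iff primes_dvd_imp_eq)
      hence "p \<le> A" using \<open>A \<noteq> 0\<close> by (intro dvd_imp_le) simp_all
      hence "p * q \<le> q * A" by (simp add: mult.commute)
      moreover have "p * B > 0" using AB(2) pos by simp
      ultimately show False using AB(1) k(1) by linarith
    qed
    thus ?thesis using diff[OF xy] by blast
  qed
  have "(\<exists>H. subgroup_spectrum S H) \<and> (card S = p \<or> card S = p ^ 2)"
  proof (cases "card S = p")
    case False
    hence gt: "card L > p" using pk k(2) D(5) dvd_imp_le[of p "card S"] by simp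
    have "S \<noteq> {}" "card S \<le> p ^ 2" using inj_fst_card[OF D(2) inj] D(5) k(2) by auto
    moreover have "F S ((a1, a2), 0) = 0" if "\<not> (int p dvd a1 \<and> int p dvd a2)" for a1 a2
      using vanish that by (rule all_directions[OF D(2) inj gt])
    ultimately have "\<exists>H. subgroup_spectrum S H" "card S = p ^ 2"
      using subgroup_spectrum_plane[OF D(3)] by blast+
    thus ?thesis by blast
  next
    case True
    have "vanishes_on S (line (x1 - y1) (x2 - y2) \<times> {0})"
      by (rule vanishes_on_line[OF vanish[OF xyL ne]])
    moreover have "card (line (x1 - y1) (x2 - y2) \<times> {0 :: int}) = card S"
      using True card_line[OF nz[OF xyL ne]] by (simp add: card_cartesian_product)
    ultimately show ?thesis using True subgroup_spectrum_iff by blast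
  qed
  thus "\<exists>H. subgroup_spectrum S H" "card S = p \<or> card S = p ^ 2" by blast+
qed

lemma good_direction:
  assumes SL: "spectral_pair S L" and k: "card S = p * q"
    and axL: "F L ((0, 0), 1) = 0"
  shows "\<exists>a1 a2. \<not> (int p dvd a1 \<and> int p dvd a2) \<and> F S ((a1, a2), 0) = 0 \<and> F S ((a1, a2), 1) = 0"
proof (rule ccontr)
  assume contra: "\<not> ?thesis"
  have bad: "F S ((a1, a2), 1) \<noteq> 0" if "\<not> (int p dvd a1 \<and> int p dvd a2)" "F S ((a1, a2), 0) = 0" for a1 a2
    using contra that by blast
  note D = spectral_pairD[OF SL]
  \<comment> \<open>The zero of \<open>F L\<close> on the axis spreads the \<open>p * q\<close>
    points of \<open>L\<close> evenly over the levels.\<close>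
  have level: "card {l \<in> L. int q dvd snd l - j} = p" for j
  proof -
    have "csum q p L snd (\<lambda>s. 0) = 0"
      using axL by (simp add: F_0_left csum_commute[of p q])
    hence "q * card {l \<in> L. int q dvd snd l - j} = card L"
      using equidistributed_fibres[OF q p p_neq_q[symmetric] D(4)] by blast
    thus ?thesis using k D(5) pos by simp
  qed
  have mate: "\<exists>y1 y2. ((y1, y2), x3) \<in> L \<and> (y1, y2) \<noteq> (x1, x2)" if x: "((x1, x2), x3) \<in> L" for x1 x2 x3
  proof (rule ccontr)
    assume no: "\<not> ?thesis"
    have "{l \<in> L. int q dvd snd l - x3} \<subseteq> {((x1, x2), x3)}"
    proof
      fix l assume l: "l \<in> {l \<in> L. int q dvd snd l - x3}"
      obtain y1 y2 y3 where y: "l = ((y1, y2), y3)" by (rule point_cases)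
      have "((x1, x2), x3) \<in> G" "((y1, y2), y3) \<in> G" using x l D(2) by (auto simp: y)
      hence "y3 = x3" using l carrier_dvd_eq(3)[of y1 y2 y3 x1 x2 x3] by (simp add: y)
      thus "l \<in> {((x1, x2), x3)}" using no l by (auto simp: y)
    qed
    hence "card {l \<in> L. int q dvd snd l - x3} \<le> card {((x1, x2), x3)}"
      by (rule card_mono[rotated]) simp
    thus False using level[of x3] pos by simp
  qed
  have nz: "\<not> (int p dvd x1 - y1 \<and> int p dvd x2 - y2)"
    if "((x1, x2), x3) \<in> G" "((y1, y2), y3) \<in> G" "(x1, x2) \<noteq> (y1, y2)" for x1 x2 x3 y1 y2 y3
    using that by (simp add: carrier_dvd_eq)
  have LG: "x \<in> G" if "x \<in> L" for x using that D(2) by blast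
  \<comment> \<open>Over two points of \<open>L\<close> with the same planar part, a level mate
    \<open>z\<close> of one would give zeros of \<open>F S\<close> in one direction at height 0 and
    at a nonzero height, against \<open>bad\<close>.\<close>
  have disjoint: "x3 = y3" if xy: "((x1, x2), x3) \<in> L" "((x1, x2), y3) \<in> L" for x1 x2 x3 y3
  proof (rule ccontr)
    assume ne: "x3 \<noteq> y3"
    obtain z1 z2 where z: "((z1, z2), x3) \<in> L" "(z1, z2) \<noteq> (x1, x2)"
      using mate[OF xy(1)] by blast
    have e: "\<not> (int p dvd z1 - x1 \<and> int p dvd z2 - x2)"
      by (rule nz[OF LG[OF z(1)] LG[OF xy(1)] z(2)])
    have "F S ((z1 - x1, z2 - x2), 0) = 0"
      using char_sum_diff[OF SL z(1) xy(1)] z(2) by simp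
    moreover have "F S ((z1 - x1, z2 - x2), x3 - y3) = 0"
      by (rule char_sum_diff[OF SL z(1) xy(2)]) (use ne in simp)
    hence "F S ((z1 - x1, z2 - x2), 1) = 0"
    proof (rule F_vanish_multiple[OF _ not_dvd_1(1)])
      show "\<not> int q dvd x3 - y3"
        using ne carrier_dvd_eq(3)[OF LG[OF xy(1)] LG[OF xy(2)]] by simp
    qed simp_all
    ultimately show False using bad[OF e] by blast
  qed
  have "L \<noteq> {}" using k pos D(5) by auto
  then obtain x where x: "x \<in> L" by blast
  obtain x1 x2 x3 where x': "x = ((x1, x2), x3)" by (rule point_cases)
  have xL: "((x1, x2), x3) \<in> L" using x by (simp only: x')
  obtain y1 y2 where y: "((y1, y2), x3) \<in> L" "(y1, y2) \<noteq> (x1, x2)"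
    using mate[OF xL] by blast
  define d1 where "d1 = y1 - x1"
  define d2 where "d2 = y2 - x2"
  have d: "\<not> (int p dvd d1 \<and> int p dvd d2)"
    unfolding d1_def d2_def by (rule nz[OF LG[OF y(1)] LG[OF xL] y(2)])
  have "F S ((y1 - x1, y2 - x2), x3 - x3) = 0"
    by (rule char_sum_diff[OF SL y(1) xL]) (use y(2) in auto)
  hence Fd0: "F S ((d1, d2), 0) = 0" by (simp add: d1_def d2_def)
  have Fd1: "F S ((d1, d2), 1) \<noteq> 0" by (rule bad[OF d Fd0])
  \<comment> \<open>A line in direction \<open>d\<close> meets only one level of \<open>L\<close>.\<close>
  have same_level: "u3 = v3"
    if uv: "((u1, u2), u3) \<in> L" "((v1, v2), v3) \<in> L" "int p dvd (u1 - v1) * d2 - (u2 - v2) * d1"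
    for u1 u2 u3 v1 v2 v3
  proof (rule ccontr)
    assume ne: "u3 \<noteq> v3"
    have "(u1, u2) \<noteq> (v1, v2)" using disjoint[of v1 v2 u3 v3] uv ne by auto
    from nz[OF LG[OF uv(1)] LG[OF uv(2)] this] obtain c where c: "\<not> int p dvd c"
        "int p dvd (u1 - v1) - c * d1" "int p dvd (u2 - v2) - c * d2"
      using prime_collinear[OF p d uv(3)] by blast
    have "F S ((u1 - v1, u2 - v2), u3 - v3) = 0"
      by (rule char_sum_diff[OF SL uv(1,2)]) (use ne in simp)
    moreover have "\<not> int q dvd u3 - v3"
      using ne carrier_dvd_eq(3)[OF LG[OF uv(1)] LG[OF uv(2)]] by simp
    ultimately have "F S ((d1, d2), 1) = 0"
      using F_vanish_multiple[OF _ c(1) _ c(2,3), of S "u3 - v3" "u3 - v3" 1] by simp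
    thus False using Fd1 by simp
  qed
  \<comment> \<open>Otherwise each line in direction \<open>(d1, d2)\<close> carries exactly
    \<open>q\<close> points of \<open>L\<close>, all in one level, and the level size
    \<open>p\<close> is a multiple of \<open>q\<close>.\<close>
  have W0: "F L ((d2, - d1), 0) \<noteq> 0"
  proof
    assume zero: "F L ((d2, - d1), 0) = 0"
    define m where "m = dot ((d2, - d1), 0)"
    have m: "m ((u1, u2), u3) = u1 * d2 - u2 * d1" for u1 u2 u3 by (simp add: m_def)
    have "csum p q L m (\<lambda>s. 0) = 0" using zero by (simp add: char_sum_csum m_def)
    hence "p * card {l \<in> L. int p dvd m l - i} = card L" for i
      by (rule equidistributed_fibres[OF p q p_neq_q D(4)])
    hence fib: "card {l \<in> L. int p dvd m l - i} = q" for i using k D(5) pos by simp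
    define Lv where "Lv = {l \<in> L. int q dvd snd l - x3}"
    have "q dvd card {l \<in> Lv. int p dvd m l - i}" for i
    proof (cases "{l \<in> Lv. int p dvd m l - i} = {}")
      case False
      then obtain u where u: "u \<in> Lv" "int p dvd m u - i" by blast
      obtain u1 u2 u3 where u': "u = ((u1, u2), u3)" by (rule point_cases)
      have "{l \<in> L. int p dvd m l - i} \<subseteq> Lv"
      proof
        fix v assume v: "v \<in> {l \<in> L. int p dvd m l - i}"
        obtain v1 v2 v3 where v': "v = ((v1, v2), v3)" by (rule point_cases)
        have "int p dvd m v - i" using v by simp
        with u(2) have "int p dvd (m u - i) - (m v - i)" by (rule dvd_diff)
        also have "(m u - i) - (m v - i) = (u1 - v1) * d2 - (u2 - v2) * d1"
          by (simp add: u' v' m algebra_simps)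
        finally have "u3 = v3"
          using same_level[of u1 u2 u3 v1 v2 v3] u(1) v by (simp add: u' v' Lv_def)
        thus "v \<in> Lv" using u(1) v by (simp add: u' v' Lv_def)
      qed
      hence "{l \<in> Lv. int p dvd m l - i} = {l \<in> L. int p dvd m l - i}"
        unfolding Lv_def by blast
      thus ?thesis using fib by simp
    qed (simp only: card.empty dvd_0_right)
    hence "q dvd (\<Sum>i\<in>{0..<int p}. card {l \<in> Lv. int p dvd m l - i})" by (rule dvd_sum)
    also have "\<dots> = card Lv" using D(4) pos by (intro sum_card_fibres) (simp_all add: Lv_def)
    also have "\<dots> = p" unfolding Lv_def by (rule level)
    finally show False using p q p_neq_q primes_dvd_imp_eq by blast
  qed
  define n where "n = dot ((d1, d2), 0)"
  define h where "h s = (n s mod int p, snd s)" for s :: point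
  have n: "n ((u1, u2), u3) = u1 * d1 + u2 * d2" for u1 u2 u3 by (simp add: n_def)
  \<comment> \<open>Two points of \<open>S\<close> with the same image differ by a planar multiple
    of \<open>(d2, - d1)\<close>, where \<open>F L\<close> would then vanish.\<close>
  have "inj_on h S"
  proof (rule inj_onI, rule ccontr)
    fix s t assume st: "s \<in> S" "t \<in> S" "h s = h t" "s \<noteq> t"
    obtain s1 s2 s3 where s': "s = ((s1, s2), s3)" by (rule point_cases)
    obtain t1 t2 t3 where t': "t = ((t1, t2), t3)" by (rule point_cases)
    have G: "((s1, s2), s3) \<in> G" "((t1, t2), t3) \<in> G" using st D(1) by (auto simp: s' t')
    have 3: "s3 = t3" and "int p dvd (s1 * d1 + s2 * d2) - (t1 * d1 + t2 * d2)"
      using st(3) by (simp_all add: h_def n s' t' mod_eq_dvd_iff)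
    hence coll: "int p dvd (s2 - t2) * d2 - (s1 - t1) * (- d1)" by (simp add: algebra_simps)
    have ne: "(s1, s2) \<noteq> (t1, t2)" using st(4) 3 by (simp add: s' t')
    have e: "\<not> (int p dvd s2 - t2 \<and> int p dvd s1 - t1)" using nz[OF G ne] by blast
    have d': "\<not> (int p dvd - d1 \<and> int p dvd d2)" using d by simp
    obtain c where c: "\<not> int p dvd c" "int p dvd (s2 - t2) - c * (- d1)" "int p dvd (s1 - t1) - c * d2"
      using prime_collinear[OF p d' coll e] by blast
    have "F L ((s1 - t1, s2 - t2), s3 - t3) = 0"
      using st D(7)[of s t] by (simp add: s' t')
    hence "F L ((s1 - t1, s2 - t2), 0) = 0" using 3 by simp
    hence "F L ((d2, - d1), 0) = 0" using c(1) not_dvd_1(2) c(3,2) by (rule F_vanish_multiple) simp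
    thus False using W0 by simp
  qed
  moreover have "h ` S \<subseteq> {0..<int p} \<times> {0..<int q}"
  proof
    fix z assume "z \<in> h ` S"
    then obtain s where s: "s \<in> S" "z = h s" by blast
    obtain s1 s2 s3 where s': "s = ((s1, s2), s3)" by (rule point_cases)
    have "((s1, s2), s3) \<in> G" using s D(1) by (auto simp: s')
    thus "z \<in> {0..<int p} \<times> {0..<int q}" using pos by (simp add: s s' h_def mem_carrier)
  qed
  moreover have "card (h ` S) = card ({0..<int p} \<times> {0..<int q})"
    using calculation(1) k by (simp add: card_image card_cartesian_product)
  ultimately have bij: "bij_betw h S ({0..<int p} \<times> {0..<int q})"
    by (simp add: bij_betw_def card_subset_eq)
  \<comment> \<open>The summand depends only on \<open>h s\<close>, so the bijection factors the sum
    into two full sums of roots of unity.\<close>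
  have "F S ((d1, d2), 1) = (\<Sum>s\<in>S. eroot p (n s mod int p) * eroot q (snd s))"
    unfolding char_sum_def n_def dot_snd[of "(d1, d2)" 1, symmetric]
    using pos by (simp add: Zp2q_char_eroot eroot_mod)
  also have "\<dots> = (\<Sum>s\<in>S. (\<lambda>(i, j). eroot p i * eroot q j) (h s))"
    by (simp add: h_def)
  also have "\<dots> = (\<Sum>(i, j)\<in>{0..<int p} \<times> {0..<int q}. eroot p i * eroot q j)"
    by (rule sum.reindex_bij_betw[OF bij])
  also have "\<dots> = (\<Sum>i\<in>{0..<int p}. eroot p i) * (\<Sum>j\<in>{0..<int q}. eroot q j)"
    by (simp add: sum_product sum.cartesian_product)
  also have "\<dots> = 0" using sum_eroot_residues pos by simp
  finally show False using Fd1 by simp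
qed

lemma vanishes_on_zero: "vanishes_on S {0}"
  by (rule vanishes_onI) (simp_all add: mod_subgroup_def)

text \<open>Beyond \<open>spectrum_large\<close> and \<open>spectrum_no_axis\<close>,
  \<open>F S\<close> vanishes on the axis and \<open>q\<close> divides \<open>card S\<close>. Either
  the axis itself is the subgroup, or a difference within a level of \<open>L\<close> adds the
  factor \<open>p\<close> and \<open>card S = p * q\<close>.\<close>

lemma ex_subgroup_spectrum:
  assumes SL: "spectral_pair S L" and S: "S \<noteq> {}"
  shows "\<exists>H. subgroup_spectrum S H"
proof -
  note D = spectral_pairD[OF SL]
  have SL': "spectral_pair L S" using SL spectral_pair_commute by blast
  have pos_k: "card S > 0" using S D by (simp add: card_gt_0_iff)
  consider "card S = 1" | "card S > p * q" | "card S > 1" "card S \<le> p * q" "F S ((0, 0), 1) \<noteq> 0"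
    | "card S > 1" "card S \<le> p * q" "F S ((0, 0), 1) = 0"
    using pos_k by linarith
  thus ?thesis
  proof cases
    case 1
    thus ?thesis using vanishes_on_zero subgroup_spectrum_iff by (intro exI[of _ "{0}"]) simp
  next
    case 2
    thus ?thesis by (rule spectrum_large[OF SL])
  next
    case 3
    thus ?thesis by (intro spectrum_no_axis(1)[OF SL])
  next
    case 4
    have vax: "vanishes_on S ({(0, 0)} \<times> {0..<int q})" using 4(3) by (rule vanishes_on_axis)
    hence qk: "q dvd card S"
      using vanishes_on_dvd[OF _ D(3)] by (fastforce simp: card_cartesian_product)
    show ?thesis
    proof (cases "card S = q")
      case True
      thus ?thesis using vax subgroup_spectrum_iff
        by (intro exI[of _ "{(0, 0)} \<times> {0..<int q}"]) (simp add: card_cartesian_product)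
    next
      case False
      have gt: "card S > q" using qk pos_k False dvd_imp_le[of q "card S"] by simp
      have "snd ` L \<subseteq> {0..<int q}" using D(2) by (auto simp: carrier_eq)
      hence "card (snd ` L) \<le> card {0..<int q}" by (intro card_mono) auto
      hence "card (snd ` L) < card L" using gt D(5) by simp
      hence "\<not> inj_on snd L" by (rule pigeonhole)
      then obtain x y where xy: "x \<in> L" "y \<in> L" "x \<noteq> y" "snd x = snd y"
        unfolding inj_on_def by blast
      obtain x1 x2 x3 where x: "x = ((x1, x2), x3)" by (rule point_cases)
      obtain y1 y2 y3 where y: "y = ((y1, y2), y3)" by (rule point_cases)
      have ne: "(x1, x2) \<noteq> (y1, y2)" "x3 = y3" using xy by (auto simp: x y)
      have G: "((x1, x2), x3) \<in> G" "((y1, y2), y3) \<in> G" using xy D(2) by (auto simp: x y)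
      have e: "\<not> (int p dvd x1 - y1 \<and> int p dvd x2 - y2)"
        using G ne(1) by (simp add: carrier_dvd_eq)
      have "F S ((x1 - y1, x2 - y2), 0) = 0"
        using char_sum_diff[OF SL, of x1 x2 x3 y1 y2 y3] xy ne by (simp add: x y)
      hence "p dvd card S"
        using vanishes_on_dvd[OF vanishes_on_line D(3)] card_line[OF e] by (fastforce simp: card_cartesian_product)
      moreover have "coprime p q" using p q p_neq_q by (simp add: primes_coprime)
      ultimately have "p * q dvd card S" using qk by (simp add: divides_mult)
      hence kpq: "card S = p * q" using 4(2) pos_k dvd_imp_le le_antisym by blast
      \<comment> \<open>With \<open>S\<close> and \<open>L\<close> exchanged,
        \<open>spectrum_no_axis\<close> would allow only the sizes \<open>p\<close> and
        \<open>p ^ 2\<close>.\<close>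
      have "F L ((0, 0), 1) = 0"
      proof (rule ccontr)
        assume "F L ((0, 0), 1) \<noteq> 0"
        hence "card L = p \<or> card L = p ^ 2"
          using 4(1) kpq D(5) by (intro spectrum_no_axis(2)[OF SL']) simp_all
        hence "q = 1 \<or> p = q" using kpq D(5) pos by (auto simp: power2_eq_square)
        thus False using pos p_neq_q by simp
      qed
      then obtain a1 a2 where a: "\<not> (int p dvd a1 \<and> int p dvd a2)"
          "F S ((a1, a2), 0) = 0" "F S ((a1, a2), 1) = 0"
        using good_direction[OF SL kpq] by blast
      have "vanishes_on S (line a1 a2 \<times> {0..<int q})"
        by (rule vanishes_on_line_axis[OF a(2,3) 4(3)])
      moreover have "card (line a1 a2 \<times> {0..<int q}) = card S"
        using card_line[OF a(1)] kpq by (simp add: card_cartesian_product)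
      ultimately show ?thesis using subgroup_spectrum_iff by blast
    qed
  qed
qed

subsection \<open>Tiles\<close>

text \<open>Addition maps \<open>S \<times> T\<close> bijectively to \<open>G\<close>, so the
  transforms multiply to that of \<open>G\<close>, which vanishes away from 0.\<close>

lemma tile_char_sums:
  assumes tile: "tile (Zp2q p q) S"
  obtains T where "T \<subseteq> G" "card S * card T = p ^ 2 * q"
    "\<And>x. red x \<noteq> 0 \<Longrightarrow> F S x = 0 \<or> F T x = 0"
proof -
  obtain T where S: "S \<subseteq> G" and T: "T \<subseteq> G" "S <#>\<^bsub>Zp2q p q\<^esub> T = G"
    "card S * card T = Coset.order (Zp2q p q)"
    using tile unfolding tile_def by blast
  define f where "f = (\<lambda>(s, t). red (s + t))"
  have img: "f ` (S \<times> T) = G"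
    unfolding T(2)[symmetric] set_mult_def f_def
    by (auto simp: mult_eq simp del: reduce.simps add_Pair)
  have card: "card S * card T = card G" using T(3) by (simp add: Coset.order_def)
  \<comment> \<open>Surjectivity together with equal finite cardinalities gives injectivity.\<close>
  have "card (f ` (S \<times> T)) = card (S \<times> T)"
    unfolding img by (simp add: card card_cartesian_product)
  hence "inj_on f (S \<times> T)"
    using S T(1) by (intro eq_card_imp_inj_on) (simp_all add: finite_subset_carrier)
  hence bij: "bij_betw f (S \<times> T) G" using img by (simp add: bij_betw_def)
  have prod: "F S x * F T x = F G x" for x
  proof -
    have "F S x * F T x = (\<Sum>(s, t)\<in>S \<times> T. chi x s * chi x t)"
      by (simp add: char_sum_def sum_product sum.cartesian_product)
    also have "\<dots> = (\<Sum>z\<in>S \<times> T. chi x (f z))"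
    proof (intro sum.cong refl)
      fix z show "(case z of (s, t) \<Rightarrow> chi x s * chi x t) = chi x (f z)"
        by (cases z) (simp only: f_def prod.case chi_red Zp2q_char_commute[of p q x] Zp2q_char_add)
    qed
    also have "\<dots> = F G x" unfolding char_sum_def by (rule sum.reindex_bij_betw[OF bij])
    finally show ?thesis .
  qed
  have "F S x = 0 \<or> F T x = 0" if "red x \<noteq> 0" for x
  proof -
    have "F G (red x) = 0"
      using vanishes_on_carrier that red_in_carrier unfolding vanishes_on_def by blast
    hence "F G x = 0" by (simp only: F_red)
    thus ?thesis using prod[of x] by simp
  qed
  with T(1) card show ?thesis by (intro that[of T]) (simp_all add: card_carrier)
qed

lemma dvd_prime_square_times_prime:
  assumes "k dvd p ^ 2 * q"
  shows "k \<in> {1, p, p ^ 2, q, p * q, p ^ 2 * q}"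
proof -
  obtain a b where ab: "k = a * b" "a dvd p ^ 2" "b dvd q" using division_decomp[OF assms] by blast
  obtain i where i: "i \<le> 2" "a = p ^ i" using ab(2) p by (auto simp: divides_primepow_nat)
  have "i = 0 \<or> i = 1 \<or> i = 2" using i(1) by linarith
  moreover have "b = 1 \<or> b = q" using ab(3) q by (auto simp: prime_nat_iff)
  ultimately show ?thesis using ab(1) i(2) by auto
qed

text \<open>In the nontrivial cases the size of \<open>T\<close> limits where \<open>F T\<close> can
  vanish; the remaining zeros must belong to \<open>S\<close>.\<close>

lemma ex_subgroup_spectrum_if_tile:
  assumes tile: "tile (Zp2q p q) S"
  shows "\<exists>H. subgroup_spectrum S H"
proof -
  have S: "S \<subseteq> G" using tile by (simp add: tile_def)
  obtain T where T: "T \<subseteq> G" and ST: "card S * card T = p ^ 2 * q"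
    and or: "\<And>x. red x \<noteq> 0 \<Longrightarrow> F S x = 0 \<or> F T x = 0"
    using tile_char_sums[OF tile] by blast
  have fin: "finite S" "finite T" using S T finite_subset_carrier by auto
  have or_dir: "F S ((a1, a2), b) = 0 \<or> F T ((a1, a2), b) = 0" if "\<not> (int p dvd a1 \<and> int p dvd a2)" for a1 a2 b
    using that by (intro or) (simp only: red_eq_0_iff, blast)
  have or_axis: "F S ((0, 0), 1) = 0 \<or> F T ((0, 0), 1) = 0"
    using not_dvd_1 by (intro or) (simp only: red_eq_0_iff, blast)
  have np: "\<not> p dvd q" "\<not> q dvd p" using p q p_neq_q primes_dvd_imp_eq by blast+
  have axis_dvd: "q dvd card U" if "F U ((0, 0), 1) = 0" "finite U" for U
    using vanishes_on_dvd[OF vanishes_on_axis[OF that(1)] that(2)] by (simp add: card_cartesian_product)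
  have dir_dvd: "p dvd card U" if "F U ((a1, a2), 0) = 0" "\<not> (int p dvd a1 \<and> int p dvd a2)" "finite U" for U a1 a2
    using vanishes_on_dvd[OF vanishes_on_line[OF that(1)] that(3)] card_line[OF that(2)]
    by (simp add: card_cartesian_product)
  have all_dvd: "p ^ 2 dvd card U"
    if "\<And>a1 a2. \<not> (int p dvd a1 \<and> int p dvd a2) \<Longrightarrow> F U ((a1, a2), 0) = 0" "finite U" for U
  proof -
    have "vanishes_on U (({0..<int p} \<times> {0..<int p}) \<times> {0})"
      using that(1) by (rule vanishes_on_plane)
    thus ?thesis using vanishes_on_dvd[OF _ that(2)] card_plane by metis
  qed
  have not_sq: "\<not> p ^ 2 dvd p * q" "\<not> p ^ 2 dvd p"
    using np pos by (simp_all add: power2_eq_square)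
  have "card S dvd p ^ 2 * q" unfolding ST[symmetric] by simp
  from dvd_prime_square_times_prime[OF this]
  consider "card S = 1" | "card S = p" | "card S = p ^ 2" | "card S = q" | "card S = p * q" | "card S = p ^ 2 * q"
    by blast
  thus ?thesis
  proof cases
    case 1
    thus ?thesis using vanishes_on_zero subgroup_spectrum_iff by (intro exI[of _ "{0}"]) simp
  next
    case 2
    hence cT: "card T = p * q" using ST pos by (simp add: power2_eq_square)
    \<comment> \<open>If \<open>F T\<close> vanished in all planar directions, \<open>p ^ 2\<close>
      would divide \<open>card T = p * q\<close>.\<close>
    have "\<exists>a1 a2. \<not> (int p dvd a1 \<and> int p dvd a2) \<and> F S ((a1, a2), 0) = 0"
    proof (rule ccontr)
      assume "\<not> ?thesis"
      hence "p ^ 2 dvd card T" using or_dir fin by (intro all_dvd) blast+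
      thus False using cT not_sq by simp
    qed
    then obtain a1 a2 where a: "\<not> (int p dvd a1 \<and> int p dvd a2)" "F S ((a1, a2), 0) = 0"
      by blast
    have "vanishes_on S (line a1 a2 \<times> {0})" using a(2) by (rule vanishes_on_line)
    moreover have "card (line a1 a2 \<times> {0 :: int}) = card S"
      using 2 card_line[OF a(1)] by (simp add: card_cartesian_product)
    ultimately show ?thesis using subgroup_spectrum_iff by blast
  next
    case 3
    hence cT: "card T = q" using ST pos by simp
    \<comment> \<open>A planar zero of \<open>F T\<close> would make \<open>p\<close> divide
      \<open>card T = q\<close>.\<close>
    have "F S ((a1, a2), 0) = 0" if "\<not> (int p dvd a1 \<and> int p dvd a2)" for a1 a2
      using or_dir[OF that, of 0] dir_dvd[OF _ that fin(2)] cT np by auto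
    hence "vanishes_on S (({0..<int p} \<times> {0..<int p}) \<times> {0})"
      by (rule vanishes_on_plane)
    thus ?thesis using 3 card_plane subgroup_spectrum_iff by metis
  next
    case 4
    hence cT: "card T = p ^ 2" using ST pos by simp
    \<comment> \<open>A zero there would make \<open>q\<close> divide \<open>p ^ 2\<close>.\<close>
    hence "F T ((0, 0), 1) \<noteq> 0" using axis_dvd[OF _ fin(2)] np q prime_dvd_power by metis
    hence "vanishes_on S ({(0, 0)} \<times> {0..<int q})"
      using or_axis by (intro vanishes_on_axis) blast
    moreover have "card ({(0 :: int, 0 :: int)} \<times> {0..<int q}) = card S"
      using 4 by (simp add: card_cartesian_product)
    ultimately show ?thesis using subgroup_spectrum_iff by blast
  next
    case 5
    hence cT: "card T = p" using ST pos by (simp add: power2_eq_square)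
    have "F T ((0, 0), 1) \<noteq> 0" using axis_dvd[OF _ fin(2)] np cT by auto
    hence ax: "F S ((0, 0), 1) = 0" using or_axis by blast
    have "\<exists>a1 a2. \<not> (int p dvd a1 \<and> int p dvd a2) \<and> F T ((a1, a2), 0) \<noteq> 0"
    proof (rule ccontr)
      assume "\<not> ?thesis"
      hence "p ^ 2 dvd card T" using fin by (intro all_dvd) blast+
      thus False using cT not_sq by simp
    qed
    then obtain a1 a2 where a: "\<not> (int p dvd a1 \<and> int p dvd a2)" "F T ((a1, a2), 0) \<noteq> 0"
      by blast
    have a0: "F S ((a1, a2), 0) = 0" using or_dir[OF a(1)] a(2) by blast
    \<comment> \<open>A zero would write \<open>p\<close> as \<open>q * A + p * B\<close> with
      \<open>A > 0\<close>; then \<open>B = 0\<close> and \<open>q\<close> divides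
      \<open>p\<close>.\<close>
    have "F T ((a1, a2), 1) \<noteq> 0"
    proof
      assume "F T ((a1, a2), 1) = 0"
      with fin(2) show False
      proof (rule F_vanish_card)
        fix A B assume AB: "card T = q * A + p * B" "A = 0 \<Longrightarrow> F T ((a1, a2), 0) = 0"
        have A: "A > 0" using AB(2) a(2) by blast
        have "B = 0"
        proof (rule ccontr)
          assume "B \<noteq> 0"
          hence "p * 1 \<le> p * B" by (intro mult_le_mono2) simp
          moreover have "q * A > 0" using A pos by simp
          ultimately show False using AB(1) cT by linarith
        qed
        hence "q dvd p" using AB(1) cT by simp
        thus False using np by blast
      qed
    qed
    hence a1: "F S ((a1, a2), 1) = 0" using or_dir[OF a(1)] by blast
    have "vanishes_on S (line a1 a2 \<times> {0..<int q})"
      by (rule vanishes_on_line_axis[OF a0 a1 ax])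
    moreover have "card (line a1 a2 \<times> {0..<int q}) = card S"
      using card_line[OF a(1)] 5 by (simp add: card_cartesian_product)
    ultimately show ?thesis using subgroup_spectrum_iff by blast
  next
    case 6
    hence "S = G" using S card_subset_eq[OF finite_carrier S] by (simp add: card_carrier)
    thus ?thesis using vanishes_on_carrier subgroup_spectrum_iff by blast
  qed
qed

end

theorem theorem1p1:
  fixes p q :: nat and S :: "((int \<times> int) \<times> int) set"
  assumes "Factorial_Ring.prime p" and "Factorial_Ring.prime q" and "p \<noteq> q"
    and "S \<subseteq> carrier (Zp2q p q)" and "S \<noteq> {}"
  shows "spectral p q S \<longleftrightarrow> tile (Zp2q p q) S"
proof -
  interpret prime_pair p q using assms(1-3) by unfold_locales
  show ?thesis
  proof
    assume "spectral p q S"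
    then obtain L where "spectral_pair S L" using spectral_iff_spectral_pair[OF assms(5)] by blast
    then obtain H where "subgroup_spectrum S H" using ex_subgroup_spectrum assms(5) by blast
    thus "tile (Zp2q p q) S" using assms(4,5) by (rule tile_if_subgroup_spectrum)
  next
    assume "tile (Zp2q p q) S"
    then obtain H where "subgroup_spectrum S H" using ex_subgroup_spectrum_if_tile by blast
    hence "spectral_pair S H" using assms(4,5) by (rule spectral_pair_if_subgroup_spectrum)
    thus "spectral p q S" using spectral_iff_spectral_pair[OF assms(5)] by blast
  qed
qed

end
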